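(* (i) Let $S\equiv\pm\{1, 3, 5, 7, 8, 26, 28, 29, 30, 31, 33, 35\}\pmod{72}$ and $T\equiv\pm\{1, 2, 5, 7, 13, 23, 28, 29, 31, 32, 34, 35\}\pmod{72}$. Then $p(S,n)=p(T,n-1)$ for all $n\geq 1$. (ii) Let $S\equiv\pm\{1, 4, 5, 6, 11, 14, 15, 21, 25, 31, 32, 35\}\pmod{72}$ and $T\equiv\pm\{1, 4, 5, 7, 10, 11, 16, 25, 26, 29, 31, 35\}\pmod{72}$. Then $p(S,n)=p(T,n)$ for all integers $n\ge0$ with $n\neq 6$. (iii) Let $S\equiv\pm\{1, 7, 8, 13, 14, 17, 19, 20, 22, 23, 29, 35\}\pmod{72}$ and $T\equiv\pm\{1, 6, 7, 13, 15, 16, 20, 21, 23, 29, 34, 35\}\pmod{72}$. Then $p(S,n)=p(T,n-1)$ for all $n\geq 1$. (iv) Let $S\equiv\pm\{2, 3, 5, 11, 16, 17, 19, 20, 25, 30, 31, 33\}\pmod{72}$ and $T\equiv\pm\{1, 5, 8, 11, 14, 17, 19, 20, 22, 25, 31, 35\}\pmod{72}$. Then $p(S,n)=p(T,n)$ for all integers $n\ge0$ with $n\neq 1$. (v) Let $S\equiv\pm\{4, 7, 10, 11, 13, 16, 17, 19, 23, 25, 26, 29\}\pmod{72}$ and $T\equiv\pm\{3, 4, 7, 13, 17, 19, 22, 23, 29, 30, 32, 33\}\pmod{72}$. Then $p(S,n)=p(T,n-4)$ for all $n\geq 4$. (vi) Let $S\equiv\pm\{6, 8, 10, 11, 13, 15,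 17, 19, 21, 23, 25, 28\}\pmod{72}$ and $T\equiv\pm\{2, 5, 11, 13, 17, 19, 23, 25, 28, 31, 32, 34\}\pmod{72}$. Then $p(S,n)=p(T,n-6)$ for all $n\geq 6$.
   Context: For a set $S$ of positive integers and an integer $n\ge 0$, $p(S,n)$ denotes the number of partitions of $n$ into parts belonging to $S$ (so $p(S,0)=1$). The notation $S\equiv\pm\{r_1,\dots,r_k\}\pmod M$ means that $S$ is the set of all positive integers $n$ such that $n\equiv r_i$ or $n\equiv -r_i\pmod M$ for some $i$. *)

theory Defs
  imports "HOL-Library.Multiset" "HOL-Number_Theory.Cong"
begin

(* A partition is the multiset of its parts.  The set below is finite, and hence its cardinality
   is the true count, whenever 0 is not in S. *)
definition partition_count :: "nat set \<Rightarrow> nat \<Rightarrow> nat" where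
  "partition_count S n = card {P :: nat multiset. set_mset P \<subseteq> S \<and> sum_mset P = n}"

definition pm_residues :: "int \<Rightarrow> int set \<Rightarrow> nat set" where
  "pm_residues M R = {n. 0 < n \<and> (\<exists>r\<in>R. [int n = r] (mod M) \<or> [int n = - r] (mod M))}"

end

theory Submission
  imports "HOL-Analysis.Analysis" Defs
begin

text \<open>
  Write \<open>\<theta>(x; p)\<close> for the product of all \<open>(1 - x p^n) (1 - p^(n+1) / x)\<close>, \<open>n \<ge> 0\<close>. Since
  \<open>\<theta>(x; p) = \<theta>(x; p^2) \<theta>(p x; p^2)\<close> and \<open>\<theta>(x; p) \<theta>(-x; p) = \<theta>(x^2; p^2)\<close>, each of the six
  generating function identities modulo 72 is an instance of Weierstrass' three-term relation with
  \<open>p = q^36\<close>, at four points of the form \<open>\<plusminus> q^(a/2)\<close> with odd \<open>a\<close>.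

  The three-term relation holds because the Jacobi triple product turns \<open>\<theta>(x y) \<theta>(x / y)\<close> into
  \<open>x\<close> times a \<open>2 \<times> 2\<close> determinant \<open>f(x) g(y) - g(x) f(y)\<close>, and such determinants satisfy the
  Pluecker relation. The triple product itself is the limit of its finite form.
\<close>

section \<open>Infinite products and theta functions\<close>

definition qpoch :: "real \<Rightarrow> real \<Rightarrow> real" where
  "qpoch a p = (\<Prod>n. 1 - a * p ^ n)"

lemma qpoch_convergent:
  fixes a p :: real
  assumes "\<bar>p\<bar> < 1"
  shows "convergent_prod (\<lambda>n. 1 - a * p ^ n)"
proof -
  have "summable (\<lambda>n. norm ((1 - a * p ^ n) - 1))"
    using assms by (auto simp: abs_mult power_abs intro!: summable_mult summable_geometric)
  thus ?thesis
    by (intro abs_convergent_prod_imp_convergent_prod summable_imp_abs_convergent_prod)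
qed

lemma qpoch_LIMSEQ:
  assumes "\<bar>p\<bar> < 1"
  shows "(\<lambda>N. \<Prod>n<N. 1 - a * p ^ n) \<longlonglongrightarrow> qpoch a p"
  unfolding qpoch_def
  by (intro has_prod_imp_tendsto' convergent_prod_has_prod qpoch_convergent assms)

lemma qpoch_pos:
  assumes "0 < p" "p < 1" "a < 1"
  shows "qpoch a p > 0"
proof -
  have "a * p ^ n < 1" for n
  proof (cases "a \<le> 0")
    case True
    have "a * p ^ n \<le> 0" using True assms by (simp add: mult_nonpos_nonneg)
    thus ?thesis by linarith
  next
    case False
    have "a * p ^ n \<le> a * 1" using False assms by (intro mult_left_mono power_le_one) auto
    thus ?thesis using assms by simp
  qed
  hence "0 < 1 - a * p ^ n" for n by (simp add: algebra_simps)
  thus ?thesis unfolding qpoch_def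
    using has_prod_pos[OF convergent_prod_has_prod[OF qpoch_convergent[of p a]]] assms by auto
qed

text \<open>The factors with even and with odd exponent form the two products on the right. Partial
  products of length \<open>2 * N\<close> split evenly, so the limit is taken along that
  subsequence.\<close>

lemma qpoch_split:
  assumes "\<bar>p\<bar> < 1"
  shows "qpoch a p = qpoch a (p\<^sup>2) * qpoch (a * p) (p\<^sup>2)"
proof -
  have p2: "\<bar>p\<^sup>2\<bar> < 1" using assms by (simp add: abs_square_less_1)
  have "(\<Prod>n<2*N. 1 - a * p ^ n) =
      (\<Prod>n<N. 1 - a * (p\<^sup>2) ^ n) * (\<Prod>n<N. 1 - (a * p) * (p\<^sup>2) ^ n)" for N
    by (induction N) (simp_all add: power_mult [symmetric] mult_ac)
  moreover have "(\<lambda>N. \<Prod>n<2*N. 1 - a * p ^ n) \<longlonglongrightarrow> qpoch a p"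
    using LIMSEQ_subseq_LIMSEQ[OF qpoch_LIMSEQ[OF assms], of "\<lambda>N. 2 * N" a]
    by (simp add: o_def strict_mono_def)
  ultimately show ?thesis
    using tendsto_mult[OF qpoch_LIMSEQ[OF p2] qpoch_LIMSEQ[OF p2]]
    by (auto intro: LIMSEQ_unique)
qed

lemma qpoch_square:
  assumes "\<bar>p\<bar> < 1"
  shows "qpoch (a\<^sup>2) (p\<^sup>2) = qpoch a p * qpoch (- a) p"
proof -
  have p2: "\<bar>p\<^sup>2\<bar> < 1" using assms by (simp add: abs_square_less_1)
  have eq: "1 - a\<^sup>2 * (p\<^sup>2) ^ n = (1 - a * p ^ n) * (1 - (- a) * p ^ n)" for n
    by (simp add: algebra_simps power2_eq_square power_mult_distrib)
  have "(\<lambda>N. \<Prod>n<N. 1 - a\<^sup>2 * (p\<^sup>2) ^ n) \<longlonglongrightarrow> qpoch a p * qpoch (- a) p"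
    unfolding eq prod.distrib by (intro tendsto_mult qpoch_LIMSEQ assms)
  thus ?thesis using qpoch_LIMSEQ[OF p2] LIMSEQ_unique by blast
qed

definition qtheta :: "real \<Rightarrow> real \<Rightarrow> real" where
  "qtheta x p = qpoch x p * qpoch (p / x) p"

lemma qtheta_pos: "0 < p \<Longrightarrow> p < x \<Longrightarrow> x < 1 \<Longrightarrow> qtheta x p > 0"
  unfolding qtheta_def by (intro mult_pos_pos qpoch_pos) auto

text \<open>Replacing \<open>x\<close> by \<open>p / x\<close> swaps the two factors.\<close>

lemma qtheta_reflect: "p \<noteq> 0 \<Longrightarrow> qtheta (p / x) p = qtheta x p"
  by (simp add: qtheta_def)

text \<open>Splitting both factors by parity gives four products, regrouped crosswise:
  \<open>p^2 / x\<close> goes with \<open>x\<close>, and \<open>p / x = p^2 / (p * x)\<close> goes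
  with \<open>p * x\<close>.\<close>

lemma qtheta_split:
  assumes "\<bar>p\<bar> < 1" "p \<noteq> 0"
  shows "qtheta x p = qtheta x (p\<^sup>2) * qtheta (p * x) (p\<^sup>2)"
  using qpoch_split[OF assms(1), of x] qpoch_split[OF assms(1), of "p / x"] assms(2)
  by (simp add: qtheta_def power2_eq_square mult_ac)

lemma qtheta_square:
  assumes "\<bar>p\<bar> < 1"
  shows "qtheta (x\<^sup>2) (p\<^sup>2) = qtheta x p * qtheta (- x) p"
  using qpoch_square[OF assms, of x] qpoch_square[OF assms, of "p / x"]
  by (simp add: qtheta_def power_divide mult_ac)

section \<open>The Jacobi triple product\<close>

text \<open>The value \<open>0\<close> at negative \<open>j\<close> makes the recurrence below hold for all integers \<open>j\<close>.\<close>

definition inv_qfact :: "real \<Rightarrow> int \<Rightarrow> real" where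
  "inv_qfact p j = (if j < 0 then 0 else 1 / (\<Prod>i<nat j. 1 - p * p ^ i))"

text \<open>At \<open>j = 0\<close> the factor \<open>1 - p powi j\<close> vanishes, which matches
  the value 0 at index -1; below that both sides are 0.\<close>

lemma inv_qfact_rec:
  assumes "0 < p" "p < 1"
  shows "inv_qfact p (j - 1) = (1 - p powi j) * inv_qfact p j"
proof (cases "j \<le> 0")
  case True
  thus ?thesis by (cases "j = 0") (auto simp: inv_qfact_def)
next
  case False
  then obtain m where m: "j = int (Suc m)" by (metis not_le zero_less_imp_eq_int Suc_pred')
  have "p * p ^ m < 1" using assms power_Suc_less_one[of p m] by simp
  thus ?thesis unfolding m by (simp add: inv_qfact_def power_int_def nat_add_distrib)
qed

section \<open>Uniform bounds and limits for inverse q-factorials\<close>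

lemma qfact_factor_bounds:
  fixes p :: real
  assumes "0 < p" "p < 1"
  shows "0 \<le> 1 - p * p ^ i" "1 - p * p ^ i \<le> 1"
  using power_Suc_less_one[of p i] assms by auto

lemma inv_qfact_nonneg: "0 < p \<Longrightarrow> p < 1 \<Longrightarrow> 0 \<le> inv_qfact p j"
  unfolding inv_qfact_def using qfact_factor_bounds by (simp add: prod_nonneg)

text \<open>All factors lie in [0, 1], so the partial products decrease to their limit. This bounds
  the inverse q-factorials uniformly in the index, as dominated convergence requires later.\<close>

lemma qpoch_le_partial:
  assumes "0 < p" "p < 1"
  shows "qpoch p p \<le> (\<Prod>i<N. 1 - p * p ^ i)"
proof (rule LIMSEQ_le_const2[OF qpoch_LIMSEQ])
  have "(\<Prod>i<n. 1 - p * p ^ i) \<le> (\<Prod>i<N. 1 - p * p ^ i)" if "n \<ge> N" for n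
    using that
  proof (induction n rule: dec_induct)
    case (step n)
    have "(\<Prod>i<Suc n. 1 - p * p ^ i) \<le> (\<Prod>i<n. 1 - p * p ^ i) * 1"
      unfolding prod.lessThan_Suc by (intro mult_left_mono prod_nonneg) (use qfact_factor_bounds assms in auto)
    with step show ?case by simp
  qed simp
  thus "\<exists>M. \<forall>n\<ge>M. (\<Prod>i<n. 1 - p * p ^ i) \<le> (\<Prod>i<N. 1 - p * p ^ i)" by blast
qed (use assms in auto)

lemma inv_qfact_le:
  assumes "0 < p" "p < 1"
  shows "inv_qfact p j \<le> 1 / qpoch p p"
  using qpoch_le_partial[OF assms, of "nat j"] qpoch_pos[OF assms assms(2)]
  by (auto simp: inv_qfact_def intro!: divide_left_mono mult_pos_pos)

lemma inv_qfact_LIMSEQ: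
  assumes "0 < p" "p < 1"
  shows "(\<lambda>n. inv_qfact p (int n + k)) \<longlonglongrightarrow> 1 / qpoch p p"
proof -
  have "(\<lambda>n. 1 / (\<Prod>i<n. 1 - p * p ^ i)) \<longlonglongrightarrow> 1 / qpoch p p"
    using qpoch_pos[OF assms assms(2)] assms by (intro tendsto_intros qpoch_LIMSEQ) auto
  moreover have "filterlim (\<lambda>n. nat (int n + k)) at_top sequentially"
    unfolding filterlim_at_top eventually_sequentially
  proof safe
    fix Z show "\<exists>N. \<forall>n\<ge>N. Z \<le> nat (int n + k)"
      by (rule exI[of _ "Z + nat \<bar>k\<bar>"]) auto
  qed
  ultimately have "(\<lambda>n. 1 / (\<Prod>i<nat (int n + k). 1 - p * p ^ i)) \<longlonglongrightarrow> 1 / qpoch p p"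
    by (rule filterlim_compose)
  \<comment> \<open>For small \<open>n\<close> the index \<open>int n + k\<close> may be negative,
    where \<open>inv_qfact\<close> is 0 but the reciprocal of the empty product is 1; hence only
    eventual equality.\<close>
  moreover have "eventually (\<lambda>n. inv_qfact p (int n + k) = 1 / (\<Prod>i<nat (int n + k). 1 - p * p ^ i))
       sequentially"
    unfolding eventually_sequentially by (rule exI[of _ "nat \<bar>k\<bar>"]) (auto simp: inv_qfact_def)
  ultimately show ?thesis by (simp add: tendsto_cong)
qed

text \<open>The Gaussian binomial coefficient of \<open>2 * n\<close> over \<open>n + k\<close> in
  base \<open>p\<close>, extended by 0 to \<open>|k| > n\<close>.\<close>

definition jtp_coeff :: "real \<Rightarrow> nat \<Rightarrow> int \<Rightarrow> real" where
  "jtp_coeff p n k = inv_qfact p (int n - k) * inv_qfact p (int n + k) * (\<Prod>i<2*n. 1 - p * p ^ i)"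

text \<open>The recurrence is what comparing coefficients of \<open>w^k\<close> predicts when the
  finite product is multiplied by \<open>(1 + w r^(2n+1)) (1 + r^(2n+1) / w)\<close>. It is verified
  directly, as a rational identity in \<open>R = r^n\<close> and \<open>K = r^k\<close>.\<close>

lemma jtp_coeff_rec:
  assumes r: "0 < r" "r < 1"
  defines "c \<equiv> \<lambda>n k. jtp_coeff (r\<^sup>2) n k * r powi (k\<^sup>2)"
  shows "c (Suc n) k = (1 + r ^ (4*n+2)) * c n k + r ^ (2*n+1) * (c n (k - 1) + c n (k + 1))"
proof -
  define p where "p = r\<^sup>2"
  have p: "0 < p" "p < 1" using r by (auto simp: p_def power_less_one_iff)
  define R where "R = r ^ n"
  define K where "K = r powi k"
  have nz: "r \<noteq> 0" "K \<noteq> 0" "R \<noteq> 0" using r by (auto simp: K_def R_def)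
  \<comment> \<open>\<open>u\<close> and \<open>v\<close> sit at the largest indices that occur, so
    \<open>inv_qfact_rec\<close> gives all other values as multiples of them, without dividing by a
    factor that may vanish.\<close>
  define u where "u = inv_qfact p (int n + 1 - k)"
  define v where "v = inv_qfact p (int n + 1 + k)"
  have pn: "p ^ n = R\<^sup>2" by (simp add: p_def R_def mult.commute flip: power_mult)
  have pk: "p powi k = K\<^sup>2" by (simp add: p_def K_def power_int_power power_int_power' mult.commute)
  have u0: "inv_qfact p (int n - k) = (1 - p * R\<^sup>2 / K\<^sup>2) * u"
    using inv_qfact_rec[OF p, of "int n + 1 - k"] p
    by (simp add: u_def power_int_diff power_int_add pn pk algebra_simps)
  have u1: "inv_qfact p (int n - (k + 1)) = (1 - R\<^sup>2 / K\<^sup>2) * (1 - p * R\<^sup>2 / K\<^sup>2) * u"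
    using inv_qfact_rec[OF p, of "int n - k"] p
    by (simp add: u0 power_int_diff power_int_add pn pk algebra_simps)
  have v0: "inv_qfact p (int n + k) = (1 - p * R\<^sup>2 * K\<^sup>2) * v"
    using inv_qfact_rec[OF p, of "int n + 1 + k"] p
    by (simp add: v_def power_int_diff power_int_add pn pk algebra_simps)
  have v1: "inv_qfact p (int n + (k - 1)) = (1 - R\<^sup>2 * K\<^sup>2) * (1 - p * R\<^sup>2 * K\<^sup>2) * v"
    using inv_qfact_rec[OF p, of "int n + k", unfolded v0] p
    by (simp add: power_int_add pn pk add_diff_eq mult.assoc)
  have u2: "inv_qfact p (int n - (k - 1)) = u" by (simp add: u_def algebra_simps)
  have v2: "inv_qfact p (int n + (k + 1)) = v" by (simp add: v_def algebra_simps)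
  have u3: "inv_qfact p (int (Suc n) - k) = u" by (simp add: u_def algebra_simps)
  have v3: "inv_qfact p (int (Suc n) + k) = v" by (simp add: v_def algebra_simps)
  define E where "E = (\<Prod>i<2*n. 1 - p * p ^ i)"
  have R4: "p ^ (2 * n) = R ^ 4" by (simp add: p_def R_def mult.commute flip: power_mult)
  have E: "(\<Prod>i<2*Suc n. 1 - p * p ^ i) = E * (1 - p * R ^ 4) * (1 - p\<^sup>2 * R ^ 4)"
    using R4 by (simp add: E_def power2_eq_square mult_ac)
  define W where "W = r powi (k\<^sup>2)"
  have rk: "r powi (2 * k) = K\<^sup>2"
    using nz power_int_add[of r k k] unfolding K_def power2_eq_square mult_2 by simp
  have sq1: "r powi ((k - 1)\<^sup>2) = W * r / K\<^sup>2"
  proof -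
    have "(k - 1)\<^sup>2 = k\<^sup>2 + 1 - 2 * k" by (simp add: power2_eq_square algebra_simps)
    thus ?thesis using nz by (simp add: W_def power_int_add power_int_diff rk)
  qed
  have sq2: "r powi ((k + 1)\<^sup>2) = W * r * K\<^sup>2"
  proof -
    have "(k + 1)\<^sup>2 = k\<^sup>2 + 1 + 2 * k" by (simp add: power2_eq_square algebra_simps)
    thus ?thesis using nz by (simp add: W_def power_int_add rk)
  qed
  have rn: "r ^ (4*n+2) = p * R ^ 4" "r ^ (2*n+1) = r * R\<^sup>2"
    by (simp_all add: p_def R_def power_add mult.commute power2_eq_square[of r] flip: power_mult)
  \<comment> \<open>This is the recurrence without the common factors \<open>u\<close>,
    \<open>v\<close>, \<open>E\<close>, \<open>W\<close>. Next, each \<open>p\<close> of the last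
    two terms splits as \<open>r * r\<close>: one \<open>r\<close> comes from
    \<open>r ^ (2*n+1)\<close>, the other from shifting \<open>k\<close> in
    \<open>k^2\<close>.\<close>
  have "(1 - p * R ^ 4) * (1 - p\<^sup>2 * R ^ 4) =
        (1 + p * R ^ 4) * (1 - p * R\<^sup>2 / K\<^sup>2) * (1 - p * R\<^sup>2 * K\<^sup>2)
        + R\<^sup>2 * ((1 - R\<^sup>2 * K\<^sup>2) * (1 - p * R\<^sup>2 * K\<^sup>2) * p / K\<^sup>2
             + (1 - R\<^sup>2 / K\<^sup>2) * (1 - p * R\<^sup>2 / K\<^sup>2) * p * K\<^sup>2)"
    using nz by (simp add: field_simps power2_eq_square power4_eq_xxxx)
  also have "\<dots> = (1 + p * R ^ 4) * (1 - p * R\<^sup>2 / K\<^sup>2) * (1 - p * R\<^sup>2 * K\<^sup>2)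
        + r * R\<^sup>2 * ((1 - R\<^sup>2 * K\<^sup>2) * (1 - p * R\<^sup>2 * K\<^sup>2) * (r / K\<^sup>2)
             + (1 - R\<^sup>2 / K\<^sup>2) * (1 - p * R\<^sup>2 / K\<^sup>2) * (r * K\<^sup>2))"
    by (simp add: p_def power2_eq_square[of r] distrib_left mult_ac)
  finally have *: "(1 - p * R ^ 4) * (1 - p\<^sup>2 * R ^ 4) = \<dots>" .
  have comb: "u * v * (E * m1 * m2) * W =
      m0 * (a0 * u * (b0 * v) * E * W) +
      r * R\<^sup>2 * (u * (b1 * b0 * v) * E * (W * r / K\<^sup>2) + a1 * a0 * u * v * E * (W * r * K\<^sup>2))"
    if "m1 * m2 = m0 * a0 * b0 + r * R\<^sup>2 * (b1 * b0 * (r / K\<^sup>2) + a1 * a0 * (r * K\<^sup>2))"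
    for m0 m1 m2 a0 a1 b0 b1
  proof -
    have "u * v * (E * m1 * m2) * W = u * v * E * W * (m1 * m2)" by simp
    also note that
    finally show ?thesis by (simp add: algebra_simps)
  qed
  show ?thesis
    unfolding c_def jtp_coeff_def p_def[symmetric] u0 u1 u2 u3 v0 v1 v2 v3 E E_def[symmetric]
      sq1 sq2 rn W_def[symmetric]
    by (rule comb[OF *])
qed

text \<open>Induction on \<open>n\<close>, where multiplication by \<open>w\<close> or
  \<open>1 / w\<close> becomes a shift of \<open>k\<close>. Summing over all integers, with zero
  terms for \<open>|k| > n\<close>, avoids boundary terms in these shifts.\<close>

lemma jacobi_triple_product_finite:
  assumes r: "0 < r" "r < 1" and w: "w \<noteq> 0"
  shows "((\<lambda>k. jtp_coeff (r\<^sup>2) n k * r powi (k\<^sup>2) * w powi k) has_sum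
            (\<Prod>i<n. (1 + w * r ^ (2*i+1)) * (1 + r ^ (2*i+1) / w))) UNIV"
proof (induction n)
  case 0
  have "((\<lambda>k. jtp_coeff (r\<^sup>2) 0 k * r powi (k\<^sup>2) * w powi k) has_sum 1) {0}"
    by (simp add: has_sum_finite_iff jtp_coeff_def inv_qfact_def)
  thus ?case
    by (subst has_sum_cong_neutral[of "{0}" _ _ _])
       (auto simp: jtp_coeff_def inv_qfact_def)
next
  case (Suc n)
  define c where "c = (\<lambda>n k. jtp_coeff (r\<^sup>2) n k * r powi (k\<^sup>2))"
  define P where "P = (\<Prod>i<n. (1 + w * r ^ (2*i+1)) * (1 + r ^ (2*i+1) / w))"
  have IH: "((\<lambda>k. c n k * w powi k) has_sum P) UNIV"
    using Suc by (simp add: c_def P_def)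
  have m: "((\<lambda>k. c n (k - 1) * w powi (k - 1)) has_sum P) UNIV"
    using has_sum_reindex_bij_witness[of UNIV "\<lambda>k. k + 1" "\<lambda>k. k - 1" UNIV
      "\<lambda>k. c n k * w powi k" "\<lambda>k. c n (k - 1) * w powi (k - 1)" P P] IH by simp
  have q: "((\<lambda>k. c n (k + 1) * w powi (k + 1)) has_sum P) UNIV"
    using has_sum_reindex_bij_witness[of UNIV "\<lambda>k. k - 1" "\<lambda>k. k + 1" UNIV
      "\<lambda>k. c n k * w powi k" "\<lambda>k. c n (k + 1) * w powi (k + 1)" P P] IH by simp
  have "((\<lambda>k. (1 + r ^ (4*n+2)) * (c n k * w powi k) +
              (r ^ (2*n+1) * w * (c n (k - 1) * w powi (k - 1)) +
               r ^ (2*n+1) / w * (c n (k + 1) * w powi (k + 1)))) has_sum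
         (1 + r ^ (4*n+2)) * P + (r ^ (2*n+1) * w * P + r ^ (2*n+1) / w * P)) UNIV"
    by (intro has_sum_add has_sum_cmult_right IH m q)
  moreover have "(1 + r ^ (4*n+2)) * (c n k * w powi k) +
              (r ^ (2*n+1) * w * (c n (k - 1) * w powi (k - 1)) +
               r ^ (2*n+1) / w * (c n (k + 1) * w powi (k + 1))) = c (Suc n) k * w powi k" for k
    unfolding c_def jtp_coeff_rec[OF r]
    using w by (simp add: power_int_diff power_int_add field_simps)
  moreover have "(1 + r ^ (4*n+2)) * P + (r ^ (2*n+1) * w * P + r ^ (2*n+1) / w * P) =
       (\<Prod>i<Suc n. (1 + w * r ^ (2*i+1)) * (1 + r ^ (2*i+1) / w))"
  proof -
    have "(\<Prod>i<Suc n. (1 + w * r ^ (2*i+1)) * (1 + r ^ (2*i+1) / w)) =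
          P * ((1 + w * r ^ (2*n+1)) * (1 + r ^ (2*n+1) / w))"
      by (simp add: P_def)
    thus ?thesis using w by (simp add: field_simps flip: power_add)
  qed
  ultimately show ?case by (simp add: c_def)
qed

section \<open>Absolute convergence of theta series and the limit of the finite triple
  product\<close>

lemma summable_theta_nat:
  fixes r w :: real
  assumes r: "0 < r" "r < 1"
  shows "summable (\<lambda>n. r ^ (n\<^sup>2) * \<bar>w\<bar> ^ n)"
proof (rule summable_comparison_test_ev)
  \<comment> \<open>The term is the n-th power of \<open>r ^ n * |w|\<close>, which tends to 0, so
    it is eventually at most \<open>(1/2) ^ n\<close>.\<close>
  have "(\<lambda>n. r ^ n * \<bar>w\<bar>) \<longlonglongrightarrow> 0 * \<bar>w\<bar>"
    using r by (intro tendsto_intros LIMSEQ_power_zero) auto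
  hence "eventually (\<lambda>n. r ^ n * \<bar>w\<bar> < 1/2) sequentially"
    by (intro order_tendstoD(2)) auto
  thus "eventually (\<lambda>n. norm (r ^ (n\<^sup>2) * \<bar>w\<bar> ^ n) \<le> (1/2) ^ n) sequentially"
  proof eventually_elim
    case (elim n)
    have "r ^ (n\<^sup>2) * \<bar>w\<bar> ^ n = (r ^ n * \<bar>w\<bar>) ^ n"
      by (simp add: power_mult_distrib power2_eq_square power_mult)
    also have "\<dots> \<le> (1/2) ^ n" using elim r by (intro power_mono) auto
    finally show ?case using r by (simp add: abs_mult)
  qed
qed (simp add: summable_geometric)

lemma abs_summable_theta:
  fixes r w :: real
  assumes r: "0 < r" "r < 1" and w: "w \<noteq> 0"
  shows "(\<lambda>k::int. \<bar>r powi (k\<^sup>2) * w powi k\<bar>) summable_on UNIV"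
proof -
  have *: "(\<lambda>n::nat. \<bar>r powi ((int n)\<^sup>2) * w powi (int n)\<bar>) summable_on UNIV"
    if "w \<noteq> 0" for w :: real
  proof -
    have "\<bar>r powi ((int n)\<^sup>2) * w powi (int n)\<bar> = r ^ (n\<^sup>2) * \<bar>w\<bar> ^ n" for n
      using r by (simp add: abs_mult power_abs flip: of_nat_power)
    thus ?thesis using summable_theta_nat[OF r, of w] r
      by (subst summable_on_UNIV_nonneg_real_iff) auto
  qed
  have 1: "(\<lambda>k::int. \<bar>r powi (k\<^sup>2) * w powi k\<bar>) summable_on range int"
    using *[OF w] by (subst summable_on_reindex) (auto simp: o_def)
  \<comment> \<open>At negative indices stands the same series with \<open>inverse w\<close> in
    place of \<open>w\<close>.\<close>
  have 2: "(\<lambda>k::int. \<bar>r powi (k\<^sup>2) * w powi k\<bar>) summable_on range (\<lambda>n. - int n)"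
    using *[of "inverse w"] w
    by (subst summable_on_reindex) (auto simp: o_def inj_on_def power_int_minus power_inverse)
  have "(UNIV :: int set) = range int \<union> range (\<lambda>n. - int n)"
    by (auto simp: image_iff) (metis int_cases2)
  thus ?thesis using summable_on_union[OF 1 2] by metis
qed

text \<open>In the finite form let \<open>n\<close> tend to infinity. With
  \<open>K = qpoch p p\<close>, the coefficient tends to \<open>(1/K) (1/K) K = 1/K\<close> and is
  bounded by \<open>1/K^2\<close>, so Tannery's theorem exchanges limit and sum.\<close>

theorem jacobi_triple_product:
  assumes r: "0 < r" "r < 1" and w: "w \<noteq> 0"
  shows "((\<lambda>k::int. r powi (k\<^sup>2) * w powi k) has_sum
           (qpoch (r\<^sup>2) (r\<^sup>2) * qtheta (- w * r) (r\<^sup>2))) UNIV"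
proof -
  define p where "p = r\<^sup>2"
  have p: "0 < p" "p < 1" using r by (auto simp: p_def power_less_one_iff)
  define K where "K = qpoch p p"
  have K: "K > 0" unfolding K_def using p by (intro qpoch_pos) auto
  define t where "t = (\<lambda>n k. jtp_coeff p n k * r powi (k\<^sup>2) * w powi k)"
  define F where "F = (\<lambda>n. \<Prod>i<n. (1 + w * r ^ (2*i+1)) * (1 + r ^ (2*i+1) / w))"
  define g where "g = (\<lambda>k::int. r powi (k\<^sup>2) * w powi k)"
  \<comment> \<open>Tannery's theorem concerns series over the naturals, so the integers are
    enumerated; absolute summability makes the order immaterial.\<close>
  have bij: "bij_betw int_decode UNIV UNIV" by (rule bij_int_decode)
  have F_lim: "F \<longlonglongrightarrow> qtheta (- w * r) p"
  proof -
    have "F = (\<lambda>n. (\<Prod>i<n. 1 - (- w * r) * p ^ i) * (\<Prod>i<n. 1 - (p / (- w * r)) * p ^ i))"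
      unfolding F_def prod.distrib using r w
      by (simp add: p_def power_mult power2_eq_square power_mult_distrib mult_ac)
    moreover have "(\<lambda>n. (\<Prod>i<n. 1 - (- w * r) * p ^ i) * (\<Prod>i<n. 1 - (p / (- w * r)) * p ^ i))
        \<longlonglongrightarrow> qtheta (- w * r) p"
      unfolding qtheta_def using p by (intro tendsto_mult qpoch_LIMSEQ) auto
    ultimately show ?thesis by simp
  qed
  have "((\<lambda>n. t n (int_decode j)) \<longlonglongrightarrow> g (int_decode j) / K)" for j
  proof -
    define k where "k = int_decode j"
    have "(\<lambda>n. \<Prod>i<2*n. 1 - p * p ^ i) \<longlonglongrightarrow> K"
      using LIMSEQ_subseq_LIMSEQ[OF qpoch_LIMSEQ[of p p], of "\<lambda>N. 2 * N"] p
      by (simp add: o_def strict_mono_def K_def)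
    hence "(\<lambda>n. inv_qfact p (int n + - k) * inv_qfact p (int n + k) * (\<Prod>i<2*n. 1 - p * p ^ i)
              * r powi (k\<^sup>2) * w powi k) \<longlonglongrightarrow> (1 / K) * (1 / K) * K * r powi (k\<^sup>2) * w powi k"
      unfolding K_def by (intro tendsto_intros inv_qfact_LIMSEQ p) (auto simp: K_def)
    thus ?thesis using K by (simp add: t_def jtp_coeff_def k_def[symmetric] g_def)
  qed
  moreover have "norm (t n (int_decode j)) \<le> \<bar>g (int_decode j)\<bar> / K\<^sup>2" for j n
  proof -
    define k where "k = int_decode j"
    have "(\<Prod>i<2*n. 1 - p * p ^ i) \<le> 1" "0 \<le> (\<Prod>i<2*n. 1 - p * p ^ i)"
      by (intro prod_le_1 prod_nonneg conjI qfact_factor_bounds p)+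
    hence "jtp_coeff p n k \<le> (1 / K) * (1 / K) * 1" "0 \<le> jtp_coeff p n k"
      unfolding jtp_coeff_def K_def using qpoch_pos[OF p p(2)]
      by (intro mult_mono inv_qfact_le inv_qfact_nonneg p mult_nonneg_nonneg
          | simp add: zero_le_divide_iff)+
    hence "\<bar>jtp_coeff p n k\<bar> \<le> 1 / K\<^sup>2" by (simp add: power2_eq_square)
    hence "\<bar>jtp_coeff p n k\<bar> * \<bar>g k\<bar> \<le> 1 / K\<^sup>2 * \<bar>g k\<bar>" by (intro mult_right_mono) auto
    thus ?thesis by (simp add: t_def g_def k_def[symmetric] abs_mult mult_ac)
  qed
  moreover have g: "summable (\<lambda>j. \<bar>g (int_decode j)\<bar>)"
    using abs_summable_theta[OF r w] summable_on_reindex_bij_betw[OF bij, of "\<lambda>k. \<bar>g k\<bar>"]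
    by (intro summable_on_imp_summable) (simp add: g_def)
  ultimately have lim: "summable (\<lambda>j. norm (g (int_decode j) / K))"
     "(\<lambda>n. \<Sum>j. t n (int_decode j)) \<longlonglongrightarrow> (\<Sum>j. g (int_decode j) / K)"
    using tannerys_theorem[of "\<lambda>j n. t n (int_decode j)" "\<lambda>j. g (int_decode j) / K" sequentially
        "\<lambda>j. \<bar>g (int_decode j)\<bar> / K\<^sup>2"]
    by (auto simp: case_prod_unfold summable_divide)
  have "(\<Sum>j. t n (int_decode j)) = F n" for n
  proof -
    have "(t n has_sum F n) UNIV"
      using jacobi_triple_product_finite[OF r w, of n] by (simp add: t_def F_def p_def)
    hence "((\<lambda>j. t n (int_decode j)) has_sum F n) UNIV"
      using has_sum_reindex_bij_betw[OF bij, of "t n"] by simp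
    thus ?thesis using has_sum_imp_sums sums_unique by metis
  qed
  with lim(2) F_lim have "(\<Sum>j. g (int_decode j) / K) = qtheta (- w * r) p"
    using LIMSEQ_unique by (metis (no_types, lifting) ext)
  hence "((\<lambda>j. g (int_decode j) / K) has_sum qtheta (- w * r) p) UNIV"
    using lim(1) norm_summable_imp_has_sum[OF lim(1)] summable_sums[OF summable_norm_cancel[OF lim(1)]]
    by (metis)
  hence "((\<lambda>j. K * (g (int_decode j) / K)) has_sum K * qtheta (- w * r) p) UNIV"
    by (rule has_sum_cmult_right)
  hence "((\<lambda>j. g (int_decode j)) has_sum K * qtheta (- w * r) p) UNIV" using K by simp
  thus ?thesis using has_sum_reindex_bij_betw[OF bij, of g] by (simp add: g_def K_def p_def)
qed

text \<open>Real summability is absolute, so the product family is summable and can be summed one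
  variable at a time.\<close>

lemma has_sum_mult_real:
  fixes f :: "'a \<Rightarrow> real" and g :: "'b \<Rightarrow> real"
  assumes f: "(f has_sum a) A" and g: "(g has_sum b) B"
  shows "((\<lambda>(x, y). f x * g y) has_sum (a * b)) (A \<times> B)"
proof (rule has_sum_SigmaI)
  show "((\<lambda>y. case (x, y) of (x, y) \<Rightarrow> f x * g y) has_sum f x * b) B" for x
    using has_sum_cmult_right[OF g] by simp
  show "((\<lambda>x. f x * b) has_sum a * b) A"
    using has_sum_cmult_left[OF f] by simp
  have fa: "(\<lambda>x. \<bar>f x\<bar>) summable_on A" and ga: "(\<lambda>x. \<bar>g x\<bar>) summable_on B"
    using f g summable_on_iff_abs_summable_on_real has_sum_imp_summable by fastforce+
  have "(\<lambda>z. case z of (x, y) \<Rightarrow> \<bar>f x\<bar> * \<bar>g y\<bar>) summable_on A \<times> B"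
    by (rule summable_on_SigmaI[where g = "\<lambda>x. \<bar>f x\<bar> * (\<Sum>\<^sub>\<infinity>y\<in>B. \<bar>g y\<bar>)"])
       (use ga in \<open>auto intro!: has_sum_cmult_right summable_on_cmult_left fa\<close>)
  thus "(\<lambda>(x, y). f x * g y) summable_on A \<times> B"
    by (subst summable_on_iff_abs_summable_on_real) (simp add: case_prod_unfold abs_mult)
qed

section \<open>The three-term relation\<close>

text \<open>The even-index and odd-index halves of the series of \<open>h^(k^2) x^k\<close>. They
  are the entries of the 2 x 2 determinant below, with \<open>h\<close> the fourth root of the
  base.\<close>

definition theta_even :: "real \<Rightarrow> real \<Rightarrow> real" where
  "theta_even h x = (\<Sum>\<^sub>\<infinity>k::int. h powi ((2*k)\<^sup>2) * x powi (2*k))"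

definition theta_odd :: "real \<Rightarrow> real \<Rightarrow> real" where
  "theta_odd h x = (\<Sum>\<^sub>\<infinity>k::int. h powi ((2*k+1)\<^sup>2) * x powi (2*k+1))"

lemma has_sum_theta_even_odd:
  assumes h: "0 < h" "h < 1" and x: "x \<noteq> 0"
  shows "((\<lambda>k::int. h powi ((2*k)\<^sup>2) * x powi (2*k)) has_sum theta_even h x) UNIV"
    and "((\<lambda>k::int. h powi ((2*k+1)\<^sup>2) * x powi (2*k+1)) has_sum theta_odd h x) UNIV"
    and "((\<lambda>k::int. h powi ((2*k-1)\<^sup>2) * x powi (2*k-1)) has_sum theta_odd h x) UNIV"
proof -
  define f where "f = (\<lambda>k::int. h powi (k\<^sup>2) * x powi k)"
  have "f summable_on UNIV"
    using jacobi_triple_product[OF h x] has_sum_imp_summable unfolding f_def by blast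
  hence S: "f summable_on range j" for j :: "int \<Rightarrow> int"
    by (rule summable_on_subset) auto
  have "inj (\<lambda>k::int. 2 * k)" "inj (\<lambda>k::int. 2 * k + 1)" by (auto simp: inj_on_def)
  from this[THEN summable_on_reindex, of f] S
  have "(\<lambda>k. f (2 * k)) summable_on UNIV" "(\<lambda>k. f (2 * k + 1)) summable_on UNIV"
    by (auto simp: o_def)
  thus "((\<lambda>k::int. h powi ((2*k)\<^sup>2) * x powi (2*k)) has_sum theta_even h x) UNIV"
    and odd: "((\<lambda>k::int. h powi ((2*k+1)\<^sup>2) * x powi (2*k+1)) has_sum theta_odd h x) UNIV"
    unfolding theta_even_def theta_odd_def f_def by simp_all
  show "((\<lambda>k::int. h powi ((2*k-1)\<^sup>2) * x powi (2*k-1)) has_sum theta_odd h x) UNIV"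
    using has_sum_reindex_bij_witness[of UNIV "\<lambda>k. k + 1" "\<lambda>k. k - 1" UNIV
      "\<lambda>k::int. h powi ((2*k+1)\<^sup>2) * x powi (2*k+1)"
      "\<lambda>k::int. h powi ((2*k-1)\<^sup>2) * x powi (2*k-1)" "theta_odd h x" "theta_odd h x"] odd
    by (simp add: algebra_simps)
qed

text \<open>Writing the double series in terms of \<open>s = m + n\<close> and \<open>d = m - n\<close>, which have equal parity,
  separates the variables.\<close>

lemma qtheta_mult_qtheta:
  assumes h: "0 < h" "h < 1" and nz: "x \<noteq> 0" "y \<noteq> 0"
  shows "(qpoch (h^4) (h^4))\<^sup>2 * (qtheta (x * y) (h^4) * qtheta (x / y) (h^4)) =
         x / h * (theta_odd h x * theta_even h y - theta_even h x * theta_odd h y)"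
proof -
  define r where "r = h\<^sup>2"
  have r: "0 < r" "r < 1" "r \<noteq> 0" and r2: "r\<^sup>2 = h ^ 4"
    using h by (auto simp: r_def power_less_one_iff simp flip: power_mult)
  \<comment> \<open>Chosen so that \<open>- u * r = x * y\<close> and
    \<open>- v * r = x / y\<close>, the arguments of theta in the triple product.\<close>
  define u v where "u = - x * y / r" and "v = - (x / y) / r"
  have uv: "u \<noteq> 0" "v \<noteq> 0" using nz r by (auto simp: u_def v_def)
  define f g where "f = (\<lambda>k::int. r powi (k\<^sup>2) * u powi k)" and "g = (\<lambda>k::int. r powi (k\<^sup>2) * v powi k)"
  define F where "F = (\<lambda>(m, n). f m * g n)"
  have "(f has_sum (qpoch (r\<^sup>2) (r\<^sup>2) * qtheta (x * y) (r\<^sup>2))) UNIV"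
    using jacobi_triple_product[OF r(1,2) uv(1)] r by (simp add: f_def u_def)
  moreover have "(g has_sum (qpoch (r\<^sup>2) (r\<^sup>2) * qtheta (x / y) (r\<^sup>2))) UNIV"
    using jacobi_triple_product[OF r(1,2) uv(2)] r by (simp add: g_def v_def)
  ultimately have "(F has_sum ((qpoch (r\<^sup>2) (r\<^sup>2) * qtheta (x * y) (r\<^sup>2)) *
        (qpoch (r\<^sup>2) (r\<^sup>2) * qtheta (x / y) (r\<^sup>2)))) (UNIV \<times> UNIV)"
    unfolding F_def by (rule has_sum_mult_real)
  hence L: "(F has_sum ((qpoch (h^4) (h^4))\<^sup>2 * (qtheta (x * y) (h^4) * qtheta (x / y) (h^4)))) UNIV"
    unfolding r2 by (simp add: power2_eq_square[of "qpoch (h^4) (h^4)"] mult_ac)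
  \<comment> \<open>\<open>i\<close> covers the pairs with sum \<open>2 * k\<close> and difference
    \<open>2 * l\<close>, \<open>j\<close> those with sum \<open>2 * k + 1\<close> and difference
    \<open>2 * l + 1\<close>.\<close>
  define i j where "i = (\<lambda>(k::int, l::int). (k + l, k - l))"
    and "j = (\<lambda>(k::int, l::int). (k + l + 1, k - l))"
  have ij: "inj i" "inj j" by (auto simp: inj_on_def i_def j_def)
  have disj: "range i \<inter> range j = {}"
  proof -
    have "i a \<noteq> j b" for a b
    proof
      assume "i a = j b"
      hence "2 * fst a = 2 * fst b + 1" by (auto simp: i_def j_def split: prod.splits)
      thus False by presburger
    qed
    thus ?thesis by blast
  qed
  have un: "range i \<union> range j = UNIV"
  proof -
    have "(m, n) \<in> range i \<union> range j" for m n
    proof (cases "even (m + n)")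
      case True
      then obtain k where "m + n = 2 * k" by (rule evenE)
      hence "(m, n) = i (k, m - k)" by (auto simp: i_def)
      thus ?thesis by blast
    next
      case False
      then obtain k where "m + n = 2 * k + 1" by (rule oddE)
      hence "(m, n) = j (k, m - k - 1)" by (auto simp: j_def)
      thus ?thesis by blast
    qed
    thus ?thesis by auto
  qed
  have uvm: "u * v = x\<^sup>2 / h ^ 4" "u / v = y\<^sup>2"
    using nz r h by (simp_all add: u_def v_def r_def field_simps power2_eq_square power4_eq_xxxx)
  have pp: "u powi (k + l) * v powi (k - l) = x powi (2*k) / h powi (4*k) * y powi (2*l)" for k l
  proof -
    have "u powi (k + l) * v powi (k - l) = (u * v) powi k * (u / v) powi l"
      using uv by (simp add: power_int_add power_int_diff power_int_mult_distrib
          power_int_divide_distrib field_simps)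
    thus ?thesis by (simp add: uvm power_int_divide_distrib power_int_mult)
  qed
  \<comment> \<open>The power \<open>h^(-4k)\<close> coming from \<open>u * v = x^2 / h^4\<close>
    completes the square: \<open>(2k)^2 - 4k = (2k-1)^2 - 1\<close>. Thus an even sum yields odd
    exponents of \<open>x\<close>.\<close>
  have Fi: "F (i (k, l)) = x / h * (h powi ((2*k-1)\<^sup>2) * x powi (2*k-1)) * (h powi ((2*l)\<^sup>2) * y powi (2*l))"
    for k l
  proof -
    have "r powi ((k + l)\<^sup>2) * r powi ((k - l)\<^sup>2) = h powi (2 * ((k + l)\<^sup>2 + (k - l)\<^sup>2))"
      using r by (simp add: r_def power_int_add power_int_mult distrib_left)
    also have "2 * ((k + l)\<^sup>2 + (k - l)\<^sup>2) = ((2*k-1)\<^sup>2 - 1 + 4 * k) + (2 * l)\<^sup>2"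
      by (simp add: power2_eq_square algebra_simps)
    also have "h powi \<dots> = h powi ((2*k-1)\<^sup>2) / h * h powi (4 * k) * h powi ((2 * l)\<^sup>2)"
      using h by (simp add: power_int_add power_int_diff)
    finally have "r powi ((k + l)\<^sup>2) * r powi ((k - l)\<^sup>2) * (u powi (k + l) * v powi (k - l)) =
        h powi ((2*k-1)\<^sup>2) / h * h powi ((2 * l)\<^sup>2) * x powi (2 * k) * y powi (2 * l)"
      unfolding pp using h by simp
    thus ?thesis using nz by (simp add: F_def i_def f_def g_def power_int_diff mult_ac)
  qed
  \<comment> \<open>Here \<open>(2k+1)^2 - 4k = (2k)^2 + 1\<close> makes the exponents of
    \<open>x\<close> even. The one extra factor \<open>u\<close> supplies the minus sign of the
    determinant.\<close>
  have Fj: "F (j (k, l)) = - x / h * (h powi ((2*k)\<^sup>2) * x powi (2*k)) * (h powi ((2*l+1)\<^sup>2) * y powi (2*l+1))"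
    for k l
  proof -
    have "r powi ((k + l + 1)\<^sup>2) * r powi ((k - l)\<^sup>2) = h powi (2 * ((k + l + 1)\<^sup>2 + (k - l)\<^sup>2))"
      using r by (simp add: r_def power_int_add power_int_mult distrib_left)
    also have "2 * ((k + l + 1)\<^sup>2 + (k - l)\<^sup>2) = ((2*k)\<^sup>2 + 1 + 4 * k) + (2 * l + 1)\<^sup>2"
      by (simp add: power2_eq_square algebra_simps)
    also have "h powi \<dots> = h powi ((2*k)\<^sup>2) * h * h powi (4 * k) * h powi ((2 * l + 1)\<^sup>2)"
      using h by (simp add: power_int_add)
    finally have "r powi ((k + l + 1)\<^sup>2) * r powi ((k - l)\<^sup>2) * (u * (u powi (k + l) * v powi (k - l))) =
        - x / h * h powi ((2*k)\<^sup>2) * h powi ((2 * l + 1)\<^sup>2) * x powi (2 * k) * (y * y powi (2 * l))"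
      unfolding pp using h by (simp add: u_def r_def power2_eq_square)
    thus ?thesis using nz uv by (simp add: F_def j_def f_def g_def power_int_add mult_ac)
  qed
  note T = has_sum_theta_even_odd[OF h]
  have Fi': "F \<circ> i = (\<lambda>(k, l). x / h * (h powi ((2*k-1)\<^sup>2) * x powi (2*k-1)) * (h powi ((2*l)\<^sup>2) * y powi (2*l)))"
    by (rule ext, simp only: o_def split_beta, subst Fi[symmetric], simp)
  have Fj': "F \<circ> j = (\<lambda>(k, l). - x / h * (h powi ((2*k)\<^sup>2) * x powi (2*k)) * (h powi ((2*l+1)\<^sup>2) * y powi (2*l+1)))"
    by (rule ext, simp only: o_def split_beta, subst Fj[symmetric], simp)
  have "((F \<circ> i) has_sum x / h * theta_odd h x * theta_even h y) (UNIV \<times> UNIV)"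
    unfolding Fi' by (intro has_sum_mult_real has_sum_cmult_right T nz)
  hence 1: "(F has_sum x / h * theta_odd h x * theta_even h y) (range i)"
    by (subst has_sum_reindex[OF ij(1)]) simp
  have "((F \<circ> j) has_sum - x / h * theta_even h x * theta_odd h y) (UNIV \<times> UNIV)"
    unfolding Fj' by (intro has_sum_mult_real has_sum_cmult_right T nz)
  hence 2: "(F has_sum - x / h * theta_even h x * theta_odd h y) (range j)"
    by (subst has_sum_reindex[OF ij(2)]) simp
  from has_sum_Un_disjoint[OF 1 2 disj] L have
    "(qpoch (h^4) (h^4))\<^sup>2 * (qtheta (x * y) (h^4) * qtheta (x / y) (h^4)) =
      x / h * theta_odd h x * theta_even h y + - x / h * theta_even h x * theta_odd h y"
    unfolding un by (blast intro: has_sum_unique)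
  thus ?thesis by (simp add: algebra_simps)
qed

text \<open>Each \<open>D a b\<close> is \<open>a / (h * K)\<close> times a 2 x 2 determinant. The
  prefactors multiply to \<open>x * u\<close> on the left and to \<open>x * y\<close> in both terms
  on the right, which explains \<open>y / u\<close>.\<close>

theorem weierstrass_three_term:
  assumes p: "0 < p" "p < 1" and nz: "x \<noteq> 0" "y \<noteq> 0" "u \<noteq> 0" "v \<noteq> 0"
  defines "D \<equiv> \<lambda>a b. qtheta (a * b) p * qtheta (a / b) p"
  shows "y / u * (D x y * D u v) = D x u * D y v - D x v * D y u"
proof -
  define h where "h = root 4 p"
  have h: "0 < h" "h < 1" "h ^ 4 = p" using p by (simp_all add: h_def)
  define K where "K = (qpoch p p)\<^sup>2"
  have K: "K \<noteq> 0" using qpoch_pos[OF p p(2)] by (simp add: K_def)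
  define E where "E = (\<lambda>a b. theta_odd h a * theta_even h b - theta_even h a * theta_odd h b)"
  have D: "D a b = a / (h * K) * E a b" if "a \<noteq> 0" "b \<noteq> 0" for a b
    using qtheta_mult_qtheta[OF h(1,2) that] K h(1) that
    by (simp add: D_def E_def h(3) K_def field_simps)
  \<comment> \<open>The Pluecker relation for the minors of a 2 x 4 matrix.\<close>
  have pl: "E x y * E u v = E x u * E y v - E x v * E y u"
    by (simp add: E_def algebra_simps)
  have "y / u * (D x y * D u v) = x * y / (h * K)\<^sup>2 * (E x y * E u v)"
    using nz by (simp add: D power2_eq_square)
  also have "\<dots> = D x u * D y v - D x v * D y u"
    unfolding pl by (simp add: D nz power2_eq_square algebra_simps diff_divide_distrib)
  finally show ?thesis .
qed

section \<open>Generating functions of restricted partitions\<close>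

text \<open>With positive parts, a partition of \<open>n\<close> has at most \<open>n\<close> parts,
  each at most \<open>n\<close>.\<close>

lemma finite_partitions:
  assumes "0 \<notin> S"
  shows "finite {P :: nat multiset. set_mset P \<subseteq> S \<and> sum_mset P = n}"
proof (rule finite_subset)
  show "finite (mset ` {xs :: nat list. set xs \<subseteq> {..n} \<and> length xs \<le> n})"
    by (intro finite_imageI finite_lists_length_le) auto
  show "{P. set_mset P \<subseteq> S \<and> sum_mset P = n} \<subseteq> mset ` {xs. set xs \<subseteq> {..n} \<and> length xs \<le> n}"
  proof clarify
    fix P :: "nat multiset" assume P: "set_mset P \<subseteq> S" and n: "n = sum_mset P"
    obtain xs where xs: "P = mset xs" by (metis ex_mset)
    have "size Q \<le> sum_mset Q" if "0 \<notin># Q" for Q :: "nat multiset"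
      using that by (induction Q) auto
    hence "length xs \<le> sum_mset P" using P assms by (metis size_mset subsetD xs)
    moreover have "x \<le> sum_mset P" if "x \<in># P" for x
      using that by (metis le_add1 multi_member_split sum_mset.add_mset)
    ultimately show "P \<in> mset ` {xs. set xs \<subseteq> {..sum_mset P} \<and> length xs \<le> sum_mset P}"
      using xs by auto
  qed
qed

lemma partition_count_mono:
  "S \<subseteq> S' \<Longrightarrow> 0 \<notin> S' \<Longrightarrow> partition_count S n \<le> partition_count S' n"
  unfolding partition_count_def by (intro card_mono finite_partitions) auto

lemma partition_count_restrict:
  assumes "n < N"
  shows "partition_count (S \<inter> {..<N}) n = partition_count S n"
proof -
  have "x < N" if "x \<in># P" "sum_mset P = n" for x and P :: "nat multiset"
    using that assms by (metis le_add1 multi_member_split sum_mset.add_mset order_le_less_trans)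
  hence "{P. set_mset P \<subseteq> S \<inter> {..<N} \<and> sum_mset P = n} = {P. set_mset P \<subseteq> S \<and> sum_mset P = n}"
    by auto
  thus ?thesis by (simp add: partition_count_def)
qed

lemma partition_count_empty: "partition_count {} n = (if n = 0 then 1 else 0)"
proof -
  have "{P :: nat multiset. set_mset P \<subseteq> {} \<and> sum_mset P = n} = (if n = 0 then {{#}} else {})"
    by auto
  thus ?thesis by (simp add: partition_count_def)
qed

text \<open>A partition either avoids \<open>k\<close> or arises from a smaller one by adding one
  copy of \<open>k\<close>.\<close>

lemma partition_count_insert:
  assumes k: "k \<notin> A" "0 < k" and A: "0 \<notin> A"
  shows "partition_count (insert k A) n =
           partition_count A n + (if k \<le> n then partition_count (insert k A) (n - k) else 0)"
proof -
  define Q where "Q = (\<lambda>S n. {P :: nat multiset. set_mset P \<subseteq> S \<and> sum_mset P = n})"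
  define I where "I = (if k \<le> n then add_mset k ` Q (insert k A) (n - k) else {})"
  have fin: "finite (Q S m)" if "0 \<notin> S" for S m
    using finite_partitions[OF that] by (simp add: Q_def)
  have "Q (insert k A) n = Q A n \<union> I"
  proof (intro equalityI subsetI)
    fix P assume P: "P \<in> Q (insert k A) n"
    show "P \<in> Q A n \<union> I"
    proof (cases "k \<in># P")
      case True
      then obtain P' where "P = add_mset k P'" by (metis multi_member_split)
      with P show ?thesis by (auto simp: Q_def I_def)
    qed (use P in \<open>auto simp: Q_def\<close>)
  qed (auto simp: Q_def I_def split: if_splits)
  moreover have "Q A n \<inter> I = {}"
  proof -
    have "k \<notin># P" if "P \<in> Q A n" for P using that k by (auto simp: Q_def)
    moreover have "k \<in># P" if "P \<in> I" for P using that by (auto simp: I_def split: if_splits)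
    ultimately show ?thesis by blast
  qed
  moreover have "card I = (if k \<le> n then card (Q (insert k A) (n - k)) else 0)"
    by (auto simp: I_def inj_on_def intro!: card_image)
  moreover have "finite I" using fin[of "insert k A"] A k by (auto simp: I_def)
  ultimately have "card (Q (insert k A) n) =
      card (Q A n) + (if k \<le> n then card (Q (insert k A) (n - k)) else 0)"
    using fin[OF A] by (simp add: card_Un_disjoint)
  thus ?thesis by (simp add: partition_count_def Q_def)
qed

text \<open>Inserting \<open>k\<close> gives partial sums with
  \<open>s_N = a_N + q^k s_(N-k)\<close>. Since they are monotone, this first bounds them by
  \<open>P / (1 - q^k)\<close>; once convergence is known, the limit solves the same
  equation.\<close>

lemma partition_gf_finite:
  assumes "finite A" "0 \<notin> A" and q: "0 < q" "q < (1::real)"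
  shows "(\<lambda>n. real (partition_count A n) * q ^ n) sums (1 / (\<Prod>k\<in>A. 1 - q ^ k))"
  using assms(1,2)
proof (induction A rule: finite_induct)
  case empty
  have "(\<lambda>n. real (partition_count {} n) * q ^ n) = (\<lambda>n. if n = 0 then 1 else 0)"
    by (auto simp: partition_count_empty)
  thus ?case using sums_single[of 0 "\<lambda>_. 1::real"] by simp
next
  case (insert k A)
  hence k: "0 < k" "k \<notin> A" "0 \<notin> A" by auto
  have qk: "q ^ k < 1" "0 < q ^ k" using q k by (auto simp: power_less_one_iff)
  define a where "a = (\<lambda>n. real (partition_count A n) * q ^ n)"
  define s where "s = (\<lambda>n. real (partition_count (insert k A) n) * q ^ n)"
  define P where "P = 1 / (\<Prod>k\<in>A. 1 - q ^ k)"
  have a: "a sums P" using insert k by (simp add: a_def P_def)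
  have "a n \<ge> 0" "s n \<ge> 0" for n using q by (auto simp: a_def s_def)
  note nonneg = this
  have s_rec: "s n = a n + (if k \<le> n then q ^ k * s (n - k) else 0)" for n
    using partition_count_insert[OF k(2,1,3), of n] q
    by (auto simp: s_def a_def algebra_simps simp flip: power_add)
  have shift: "(\<Sum>n<N. if k \<le> n then q ^ k * s (n - k) else 0) = q ^ k * (\<Sum>n<N-k. s n)" for N
    by (induction N) (auto simp: Suc_diff_le algebra_simps)
  have T: "(\<Sum>n<N. s n) = (\<Sum>n<N. a n) + q ^ k * (\<Sum>n<N-k. s n)" for N
  proof -
    have "(\<Sum>n<N. s n) = (\<Sum>n<N. a n + (if k \<le> n then q ^ k * s (n - k) else 0))"
      by (intro sum.cong refl s_rec)
    thus ?thesis by (simp add: sum.distrib shift)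
  qed
  have "(\<Sum>n<N. s n) \<le> P / (1 - q ^ k)" for N
  proof -
    have "(\<Sum>n<N. s n) \<le> P + q ^ k * (\<Sum>n<N. s n)"
    proof -
      have "(\<Sum>n<N. a n) \<le> P"
        using sum_le_suminf[OF sums_summable[OF a], of "{..<N}"] nonneg sums_unique[OF a] by simp
      moreover have "(\<Sum>n<N-k. s n) \<le> (\<Sum>n<N. s n)" using nonneg by (intro sum_mono2) auto
      ultimately show ?thesis
        using T[of N] mult_left_mono[of "\<Sum>n<N-k. s n" "\<Sum>n<N. s n" "q ^ k"] qk by linarith
    qed
    thus ?thesis using qk by (simp add: field_simps)
  qed
  hence sm: "summable s" by (intro summableI_nonneg_bounded nonneg)
  have "(\<lambda>N. (\<Sum>n<N + k. a n) + q ^ k * (\<Sum>n<N. s n)) \<longlonglongrightarrow> P + q ^ k * suminf s"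
    using a[unfolded sums_def] summable_LIMSEQ[OF sm]
    by (intro tendsto_intros) (auto intro: LIMSEQ_ignore_initial_segment)
  moreover have "(\<lambda>N. (\<Sum>n<N + k. a n) + q ^ k * (\<Sum>n<N. s n)) \<longlonglongrightarrow> suminf s"
    using LIMSEQ_ignore_initial_segment[OF summable_LIMSEQ[OF sm], of k] T[of "_ + k"] by simp
  ultimately have "suminf s = P + q ^ k * suminf s"
    by (intro LIMSEQ_unique)
  hence "suminf s = P / (1 - q ^ k)" using qk by (simp add: field_simps)
  also have "\<dots> = 1 / (\<Prod>k\<in>insert k A. 1 - q ^ k)"
    using insert by (simp add: P_def mult.commute)
  finally show ?case using summable_sums[OF sm] by (simp add: s_def)
qed

text \<open>A squeeze: counts below \<open>m N\<close> use only parts below \<open>m N\<close>, so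
  the partial sum up to \<open>m N\<close> is at most \<open>P N\<close>, and \<open>P N\<close> is
  at most the full series. The free cutoff \<open>m\<close> allows truncation at whole
  periods.\<close>

lemma partition_gf:
  assumes S: "0 \<notin> S" and q: "0 < q" "q < (1::real)"
    and m: "filterlim m at_top sequentially"
    and L: "(\<lambda>N. \<Prod>k\<in>S \<inter> {..<m N}. 1 - q ^ k) \<longlonglongrightarrow> L" "L \<noteq> 0"
  shows "(\<lambda>n. real (partition_count S n) * q ^ n) sums (1 / L)"
proof -
  define c where "c = (\<lambda>n. real (partition_count S n) * q ^ n)"
  define d where "d = (\<lambda>N n. real (partition_count (S \<inter> {..<m N}) n) * q ^ n)"
  define P where "P = (\<lambda>N. 1 / (\<Prod>k\<in>S \<inter> {..<m N}. 1 - q ^ k))"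
  have d: "d N sums P N" for N
    unfolding d_def P_def using S q by (intro partition_gf_finite) auto
  have dc: "d N n \<le> c n" "0 \<le> d N n" "0 \<le> c n" for N n
    unfolding d_def c_def using S q
    by (auto intro!: mult_right_mono partition_count_mono)
  have P_lim: "P \<longlonglongrightarrow> 1 / L" unfolding P_def by (intro tendsto_intros L)
  have le_P: "(\<Sum>n<m N. c n) \<le> P N" for N
  proof -
    have "(\<Sum>n<m N. c n) = (\<Sum>n<m N. d N n)"
      by (intro sum.cong) (auto simp: c_def d_def partition_count_restrict)
    also have "\<dots> \<le> P N"
      using sum_le_suminf[OF sums_summable[OF d], of "{..<m N}" N] dc sums_unique[OF d] by auto
    finally show ?thesis .
  qed
  obtain B where B: "P N \<le> B" for N
    using convergent_imp_Bseq[OF convergentI[OF P_lim]] unfolding Bseq_def by (metis abs_le_D1 real_norm_def)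
  have "(\<Sum>n<K. c n) \<le> B" for K
  proof -
    obtain N where "K \<le> m N"
      using m unfolding filterlim_at_top eventually_sequentially by blast
    hence "(\<Sum>n<K. c n) \<le> (\<Sum>n<m N. c n)" using dc by (intro sum_mono2) auto
    also note le_P also note B
    finally show ?thesis .
  qed
  hence sm: "summable c" by (intro summableI_nonneg_bounded dc)
  have "(\<lambda>N. \<Sum>n<m N. c n) \<longlonglongrightarrow> suminf c"
    using filterlim_compose[OF summable_LIMSEQ[OF sm] m] .
  hence "suminf c \<le> 1 / L" using le_P P_lim by (auto intro: LIMSEQ_le)
  moreover have "P N \<le> suminf c" for N
    using suminf_le[OF _ sums_summable[OF d] sm, of N] dc sums_unique[OF d] by simp
  hence "1 / L \<le> suminf c" using P_lim by (auto intro: LIMSEQ_le_const2)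
  ultimately show ?thesis using summable_sums[OF sm] by (simp add: c_def)
qed

section \<open>Parts in symmetric residue classes\<close>

lemma mod_in_pm_residues_iff:
  assumes R: "\<And>r. r \<in> R \<Longrightarrow> 0 < r \<and> 2 * r < m"
  shows "n \<in> pm_residues (int m) (int ` R) \<longleftrightarrow> n mod m \<in> R \<union> (\<lambda>r. m - r) ` R"
proof -
  have 1: "[int n = int r] (mod int m) \<longleftrightarrow> n mod m = r" if "r \<in> R" for r
    using R[OF that] unfolding cong_int_iff by (simp add: cong_def)
  have 2: "[int n = - int r] (mod int m) \<longleftrightarrow> n mod m = m - r" if "r \<in> R" for r
  proof -
    have "[int n = - int r] (mod int m) \<longleftrightarrow> [int n = int (m - r)] (mod int m)"
      using R[OF that] by (simp add: cong_def of_nat_diff)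
    also have "\<dots> \<longleftrightarrow> n mod m = m - r"
      using R[OF that] unfolding cong_int_iff by (simp add: cong_def)
    finally show ?thesis .
  qed
  \<comment> \<open>As \<open>0 < r < m\<close>, neither \<open>r\<close> nor \<open>m - r\<close>
    is 0, so the positivity demanded by \<open>pm_residues\<close> is automatic.\<close>
  have 3: "n mod m \<noteq> 0" if "n mod m \<in> R \<union> (\<lambda>r. m - r) ` R"
    using that R by fastforce
  have "n > 0" if "n mod m \<noteq> 0" using that by (cases n) auto
  thus ?thesis unfolding pm_residues_def using 1 2 3 by auto
qed

text \<open>Below \<open>m * N\<close> lie \<open>N\<close> full periods, so division with remainder
  splits the truncated product into one finite q-product per residue. The limits for
  \<open>r\<close> and \<open>m - r\<close> combine into one theta function.\<close>

lemma partition_gf_pm_residues: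
  assumes R: "\<And>r. r \<in> R \<Longrightarrow> 0 < r \<and> 2 * r < m" and m: "0 < m"
    and q: "0 < q" "q < (1::real)"
  shows "(\<lambda>n. real (partition_count (pm_residues (int m) (int ` R)) n) * q ^ n) sums
           (1 / (\<Prod>r\<in>R. qtheta (q ^ r) (q ^ m)))"
proof (rule partition_gf[OF _ q])
  define S where "S = pm_residues (int m) (int ` R)"
  define Q where "Q = R \<union> (\<lambda>r. m - r) ` R"
  have S: "n \<in> S \<longleftrightarrow> n mod m \<in> Q" for n
    using mod_in_pm_residues_iff[of R m n] R by (simp add: S_def Q_def)
  have finR: "finite R" by (rule finite_subset[of _ "{..<m}"]) (use R in fastforce)+
  have Qm: "a < m" if "a \<in> Q" for a using that R by (fastforce simp: Q_def)
  have qm: "\<bar>q ^ m\<bar> < 1" using q m by (simp add: power_less_one_iff abs_if)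
  show "0 \<notin> S" by (simp add: S_def pm_residues_def)
  show "filterlim (\<lambda>N. m * N) at_top sequentially"
    unfolding filterlim_at_top eventually_sequentially
  proof (intro allI exI impI)
    fix Z n :: nat assume "Z \<le> n"
    thus "Z \<le> m * n" using mult_le_mono[of 1 m Z n] m by simp
  qed
  have "(\<Prod>k\<in>S \<inter> {..<m * N}. 1 - q ^ k) = (\<Prod>a\<in>Q. \<Prod>i<N. 1 - q ^ a * (q ^ m) ^ i)" for N
  proof -
    have "(\<Prod>k\<in>S \<inter> {..<m * N}. 1 - q ^ k) =
          (\<Prod>(a, i)\<in>Q \<times> {..<N}. 1 - q ^ a * (q ^ m) ^ i)"
    proof (rule prod.reindex_bij_witness[of _ "\<lambda>(a, i). m * i + a" "\<lambda>n. (n mod m, n div m)"])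
      fix z assume z: "z \<in> Q \<times> {..<N}"
      obtain a i where [simp]: "z = (a, i)" by (cases z)
      have "m * i + a < m * Suc i" using z Qm by simp
      also have "\<dots> \<le> m * N" using z by (intro mult_left_mono) auto
      finally show "(case z of (a, i) \<Rightarrow> m * i + a) \<in> S \<inter> {..<m * N}"
        using z Qm by (simp add: S)
      show "((case z of (a, i) \<Rightarrow> m * i + a) mod m, (case z of (a, i) \<Rightarrow> m * i + a) div m) = z"
        using z Qm m by simp
    next
      fix n assume n: "n \<in> S \<inter> {..<m * N}"
      show "(case (n mod m, n div m) of (a, i) \<Rightarrow> m * i + a) = n" by simp
      show "(n mod m, n div m) \<in> Q \<times> {..<N}"
        using n by (auto simp: S less_mult_imp_div_less mult.commute)
      have "q ^ (n mod m) * (q ^ m) ^ (n div m) = q ^ (n mod m + m * (n div m))"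
        by (simp only: power_add power_mult)
      thus "(case (n mod m, n div m) of (a, i) \<Rightarrow> 1 - q ^ a * (q ^ m) ^ i) = 1 - q ^ n" by simp
    qed
    thus ?thesis by (simp add: prod.cartesian_product)
  qed
  moreover have "(\<lambda>N. \<Prod>a\<in>Q. \<Prod>i<N. 1 - q ^ a * (q ^ m) ^ i) \<longlonglongrightarrow> (\<Prod>a\<in>Q. qpoch (q ^ a) (q ^ m))"
    by (intro tendsto_prod qpoch_LIMSEQ qm)
  moreover have "(\<Prod>a\<in>Q. qpoch (q ^ a) (q ^ m)) = (\<Prod>r\<in>R. qtheta (q ^ r) (q ^ m))"
  proof -
    \<comment> \<open>\<open>2 * r < m\<close> separates the classes \<open>r\<close> and
      \<open>m - r'\<close>, so no factor is counted twice.\<close>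
    have "r \<noteq> m - r'" if "r \<in> R" "r' \<in> R" for r r' using R[OF that(1)] R[OF that(2)] by linarith
    hence "R \<inter> (\<lambda>r. m - r) ` R = {}" by blast
    moreover have "r = r'" if "r \<in> R" "r' \<in> R" "m - r = m - r'" for r r'
      using R[OF that(1)] R[OF that(2)] that(3) by linarith
    hence "inj_on (\<lambda>r. m - r) R" by (auto simp: inj_on_def)
    ultimately have "(\<Prod>a\<in>Q. qpoch (q ^ a) (q ^ m)) =
        (\<Prod>r\<in>R. qpoch (q ^ r) (q ^ m)) * (\<Prod>r\<in>R. qpoch (q ^ (m - r)) (q ^ m))"
      unfolding Q_def using finR by (simp add: prod.union_disjoint prod.reindex)
    also have "\<dots> = (\<Prod>r\<in>R. qpoch (q ^ r) (q ^ m) * qpoch (q ^ (m - r)) (q ^ m))"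
      by (simp add: prod.distrib)
    also have "\<dots> = (\<Prod>r\<in>R. qtheta (q ^ r) (q ^ m))"
    proof (rule prod.cong)
      fix r assume "r \<in> R"
      hence "q ^ (m - r) = q ^ m / q ^ r" using R[of r] q by (simp add: power_diff)
      thus "qpoch (q ^ r) (q ^ m) * qpoch (q ^ (m - r)) (q ^ m) = qtheta (q ^ r) (q ^ m)"
        by (simp add: qtheta_def)
    qed simp
    finally show ?thesis .
  qed
  ultimately show "(\<lambda>N. \<Prod>k\<in>S \<inter> {..<m * N}. 1 - q ^ k) \<longlonglongrightarrow> (\<Prod>r\<in>R. qtheta (q ^ r) (q ^ m))"
    by simp
  show "(\<Prod>r\<in>R. qtheta (q ^ r) (q ^ m)) \<noteq> 0"
  proof -
    have "qtheta (q ^ r) (q ^ m) > 0" if "r \<in> R" for r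
      using R[OF that] q by (intro qtheta_pos) (auto simp: power_less_one_iff power_strict_decreasing_iff)
    hence "\<forall>r\<in>R. qtheta (q ^ r) (q ^ m) \<noteq> 0" by fastforce
    thus ?thesis using finR by simp
  qed
qed

section \<open>From identities on the interval (0, 1) to identities of coefficients\<close>

lemma power_series_eq_0:
  fixes c :: "nat \<Rightarrow> real"
  assumes "\<And>x. 0 < x \<Longrightarrow> x < 1 \<Longrightarrow> (\<lambda>n. c n * x ^ n) sums 0"
  shows "c n = 0"
proof (induction n rule: less_induct)
  case (less n)
  \<comment> \<open>By induction the terms below \<open>n\<close> vanish; after division by
    \<open>x^n\<close> the limit from the right at 0 isolates \<open>c n\<close>.\<close>
  define d where "d = (\<lambda>k. c (k + n))"
  have d: "(\<lambda>k. d k * x ^ k) sums 0" if x: "0 < x" "x < 1" for x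
  proof -
    have "(\<lambda>k. c (k + n) * x ^ (k + n)) sums (0 - (\<Sum>i<n. c i * x ^ i))"
      by (rule sums_split_initial_segment) (use assms x in auto)
    hence "(\<lambda>k. c (k + n) * x ^ (k + n) / x ^ n) sums (0 / x ^ n)"
      using less by (intro sums_divide) simp
    thus ?thesis using x by (simp add: d_def power_add)
  qed
  \<comment> \<open>The point \<open>(|x| + 1) / 2\<close> lies strictly between \<open>|x|\<close>
    and 1, so convergence there extends to \<open>x\<close> of either sign.\<close>
  have sm: "(\<lambda>k. d k * x ^ k) sums (\<Sum>k. d k * x ^ k)" if "norm x < 1" for x
    using powser_inside[of d "(\<bar>x\<bar> + 1) / 2" x] sums_summable[OF d[of "(\<bar>x\<bar> + 1) / 2"]] that
    by (intro summable_sums) auto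
  have "((\<lambda>x. \<Sum>k. d k * x ^ k) \<longlongrightarrow> d 0) (at_right 0)"
    using powser_limit_0_strong[of 1 d, OF _ sm] by (rule filterlim_mono) (auto simp: at_le)
  moreover have "eventually (\<lambda>x. (\<Sum>k. d k * x ^ k) = 0) (at_right 0)"
    unfolding eventually_at_right_field using d sums_unique by (intro exI[of _ 1]) fastforce
  hence "((\<lambda>x. \<Sum>k. d k * x ^ k) \<longlongrightarrow> 0) (at_right 0)"
    by (rule tendsto_eventually)
  ultimately show ?case using tendsto_unique[of "at_right (0::real)"] by (fastforce simp: d_def)
qed

text \<open>The monomial \<open>c * q ^ j\<close> affects the single coefficient
  \<open>n = j\<close>, which produces the exceptional index; \<open>q ^ k\<close> produces the
  shift. The equation is over the reals because \<open>c\<close> may be negative.\<close>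

lemma partition_count_shifted:
  fixes c :: real
  assumes R: "\<forall>r\<in>R \<union> R'. 0 < r \<and> 2 * r < m" and m: "0 < m"
    and eq: "\<And>q. 0 < q \<Longrightarrow> q < 1 \<Longrightarrow>
       1 / (\<Prod>r\<in>R. qtheta (q ^ r) (q ^ m)) = c * q ^ j + q ^ k / (\<Prod>r\<in>R'. qtheta (q ^ r) (q ^ m))"
  shows "real (partition_count (pm_residues (int m) (int ` R)) n) =
         (if n = j then c else 0) +
         (if k \<le> n then real (partition_count (pm_residues (int m) (int ` R')) (n - k)) else 0)"
proof -
  define a b where "a = (\<lambda>n. real (partition_count (pm_residues (int m) (int ` R)) n))"
    and "b = (\<lambda>n. real (partition_count (pm_residues (int m) (int ` R')) n))"
  define e where "e = (\<lambda>n. a n - ((if n = j then c else 0) + (if k \<le> n then b (n - k) else 0)))"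
  have "e n = 0"
  proof (rule power_series_eq_0)
    fix q :: real assume q: "0 < q" "q < 1"
    define B where "B = 1 / (\<Prod>r\<in>R'. qtheta (q ^ r) (q ^ m))"
    have a: "(\<lambda>n. a n * q ^ n) sums (c * q ^ j + q ^ k * B)"
      using partition_gf_pm_residues[OF _ m q, of R] R eq[OF q] by (simp add: a_def B_def)
    have b: "(\<lambda>n. b n * q ^ n) sums B"
      using partition_gf_pm_residues[OF _ m q, of R'] R by (simp add: b_def B_def)
    have "(\<lambda>n. if k \<le> n then b (n - k) * q ^ n else 0) sums (q ^ k * B)"
    proof (subst sums_zero_iff_shift[of k, symmetric])
      show "(\<lambda>i. if k \<le> i + k then b (i + k - k) * q ^ (i + k) else 0) sums (q ^ k * B)"
        using sums_mult[OF b, of "q ^ k"] by (simp add: power_add mult_ac)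
    qed simp
    moreover have "(\<lambda>n. if n = j then c * q ^ n else 0) sums (c * q ^ j)"
      by (rule sums_single)
    ultimately have "(\<lambda>n. a n * q ^ n - ((if n = j then c * q ^ n else 0) +
        (if k \<le> n then b (n - k) * q ^ n else 0))) sums (c * q ^ j + q ^ k * B - (c * q ^ j + q ^ k * B))"
      by (intro sums_diff sums_add a)
    moreover have "a n * q ^ n - ((if n = j then c * q ^ n else 0) +
        (if k \<le> n then b (n - k) * q ^ n else 0)) = e n * q ^ n" for n
      by (simp add: e_def algebra_simps)
    ultimately show "(\<lambda>n. e n * q ^ n) sums 0" by simp
  qed
  thus ?thesis by (simp add: e_def a_def b_def)
qed

section \<open>The theta function identities modulo 72\<close>

definition theta36 :: "real \<Rightarrow> real \<Rightarrow> nat \<Rightarrow> real" where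
  "theta36 q s a = qtheta (s * q ^ a) (q ^ 36)"

definition theta72 :: "real \<Rightarrow> nat \<Rightarrow> real" where
  "theta72 q a = qtheta (q ^ a) (q ^ 72)"

lemma theta72_reflect: "0 < q \<Longrightarrow> a \<le> 72 \<Longrightarrow> theta72 q (72 - a) = theta72 q a"
  using qtheta_reflect[of "q ^ 72" "q ^ a"] by (simp add: theta72_def power_diff)

lemma theta72_pos: "0 < q \<Longrightarrow> q < 1 \<Longrightarrow> 0 < a \<Longrightarrow> a < 72 \<Longrightarrow> 0 < theta72 q a"
  unfolding theta72_def by (intro qtheta_pos) (auto simp: power_less_one_iff power_strict_decreasing_iff)

text \<open>\<open>qtheta_split\<close> yields the indices \<open>a\<close> and
  \<open>36 + a\<close>; reflection turns the latter into \<open>36 - a\<close>.\<close>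

lemma theta36_pos_sign:
  assumes q: "0 < q" "q < 1" and a: "a \<le> 36"
  shows "theta36 q 1 a = theta72 q a * theta72 q (36 - a)"
proof -
  have "theta36 q 1 a = theta72 q a * theta72 q (36 + a)"
    using qtheta_split[of "q ^ 36" "q ^ a"] q
    by (simp add: theta36_def theta72_def power_less_one_iff abs_if power_add flip: power_mult)
  also have "theta72 q (36 + a) = theta72 q (36 - a)"
    using theta72_reflect[OF q(1), of "36 + a"] a by simp
  finally show ?thesis .
qed

text \<open>The product of the values at both signs is \<open>theta72 q (2 * a)\<close> by
  \<open>qtheta_square\<close>; divide by the positive one.\<close>

lemma theta36_neg_sign:
  assumes q: "0 < q" "q < 1" and a: "0 < a" "a < 36"
  shows "theta36 q (-1) a = theta72 q (2 * a) / (theta72 q a * theta72 q (36 - a))"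
proof -
  have "theta72 q (2 * a) = theta36 q 1 a * theta36 q (-1) a"
    using qtheta_square[of "q ^ 36" "q ^ a"] q
    by (simp add: theta36_def theta72_def power_less_one_iff abs_if mult.commute flip: power_mult)
  moreover have "theta72 q a * theta72 q (36 - a) \<noteq> 0"
    using theta72_pos[OF q] a by (simp add: less_imp_neq[symmetric])
  ultimately show ?thesis using theta36_pos_sign[OF q, of a] a by (simp add: field_simps)
qed

text \<open>At the points \<open>s q^(a/2)\<close> with odd \<open>a\<close>, products and quotients
  have integral exponents, and a quotient of signs equals their product. The ordering keeps natural
  subtraction exact.\<close>

lemma theta36_three_term:
  assumes q: "0 < q" "q < 1" and s: "\<bar>s1\<bar> = 1" "\<bar>s2\<bar> = 1" "\<bar>s3\<bar> = 1" "\<bar>s4\<bar> = 1"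
    and odd: "odd a" "odd b" "odd c" "odd d" and le: "d \<le> c" "c \<le> b" "b \<le> a"
  defines "D \<equiv> \<lambda>s s' a b. theta36 q (s * s') ((a + b) div 2) * theta36 q (s * s') ((a - b) div 2)"
  shows "s2 * s3 * q ^ ((b - c) div 2) * (D s1 s2 a b * D s3 s4 c d) =
         D s1 s3 a c * D s2 s4 b d - D s1 s4 a d * D s2 s3 b c"
proof -
  define t where "t = sqrt q"
  have t: "t > 0" "t\<^sup>2 = q" using q by (simp_all add: t_def)
  have prod: "(s * t ^ m) * (s' * t ^ n) = s * s' * q ^ ((m + n) div 2)"
    if "odd m" "odd n" for s s' m n
  proof -
    have "t ^ m * t ^ n = t ^ (2 * ((m + n) div 2))"
      using that by (simp flip: power_add)
    thus ?thesis using t(2) by (simp add: power_mult mult_ac)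
  qed
  have quot: "(s * t ^ m) / (s' * t ^ n) = s * s' * q ^ ((m - n) div 2)"
    if "odd m" "odd n" "n \<le> m" "\<bar>s'\<bar> = 1" for s s' m n
  proof -
    have "t ^ m / t ^ n = t ^ (2 * ((m - n) div 2))"
      using that t by (simp add: power_diff)
    moreover have "s / s' = s * s'" using that by (auto simp: abs_if split: if_splits)
    ultimately show ?thesis using t(2) by (metis power_mult times_divide_times_eq)
  qed
  have nz: "s * t ^ m \<noteq> 0" if "\<bar>s\<bar> = 1" for s m using that t by auto
  have "q ^ 36 > 0" "q ^ 36 < 1" using q by (auto simp: power_less_one_iff)
  from weierstrass_three_term[OF this nz[OF s(1), of a] nz[OF s(2), of b] nz[OF s(3), of c] nz[OF s(4), of d]]
  show ?thesis using s odd le by (simp add: prod quot D_def theta36_def)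
qed

text \<open>The bound \<open>36 < a\<close> orients reflection as a terminating rewrite rule that
  folds indices to at most 36.\<close>

lemma theta72_fold: "0 < q \<Longrightarrow> 36 < a \<Longrightarrow> a \<le> 72 \<Longrightarrow> theta72 q a = theta72 q (72 - a)"
  using theta72_reflect by simp

lemma theta72_nonzero: "0 < q \<Longrightarrow> q < 1 \<Longrightarrow> 0 < a \<Longrightarrow> a < 72 \<Longrightarrow> theta72 q a \<noteq> 0"
  using theta72_pos by (simp add: less_imp_neq[symmetric])

text \<open>Here \<open>A / Z = 1 / S\<close> and \<open>B / Z = 1 / T\<close>; divide the linear
  relation by \<open>Z\<close>.\<close>

lemma quotient_identity:
  fixes Z A B S T c d :: real
  assumes "Z \<noteq> 0" "A * S = Z" "B * T = Z" "A = Z * c + d * B"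
  shows "1 / S = c + d / T"
proof -
  have "S \<noteq> 0" "T \<noteq> 0" using assms by auto
  hence "1 / S = A / Z" "d / T = d * B / Z"
    using assms(1-3) by (simp_all add: frac_eq_eq mult_ac)
  thus ?thesis using assms(1,4) by (simp add: add_divide_distrib)
qed

text \<open>The six instances of the three-term relation are conjugate under multiplication of the residues
  by units modulo 72.\<close>

lemma theta_identity_i:
  assumes q: "0 < q" "q < 1"
  shows "1 / (\<Prod>r\<in>{1, 3, 5, 7, 8, 26, 28, 29, 30, 31, 33, 35}. qtheta (q ^ r) (q ^ 72)) =
         1 * q ^ 0 + q ^ 1 / (\<Prod>r\<in>{1, 2, 5, 7, 13, 23, 28, 29, 31, 32, 34, 35}. qtheta (q ^ r) (q ^ 72))"
proof -
  note simps = theta36_pos_sign[OF q] theta36_neg_sign[OF q] theta72_fold[OF q(1)] theta72_nonzero[OF q]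
  \<comment> \<open>Two of the four points are positive and two negative. The pairing of equal signs
    gives \<open>Z\<close>; the two pairings of opposite signs give \<open>A\<close> and
    \<open>B\<close>, whose quotients by \<open>Z\<close> reduce to the reciprocals of the two
    twelve-fold products.\<close>
  define Z where "Z = theta36 q 1 26 * theta36 q 1 7 * theta36 q 1 28 * theta36 q 1 1"
  define A where "A = theta36 q (-1) 30 * theta36 q (-1) 3 * theta36 q (-1) 24 * theta36 q (-1) 5"
  define B where "B = theta36 q (-1) 31 * theta36 q (-1) 2 * theta36 q (-1) 23 * theta36 q (-1) 4"
  have Z: "Z \<noteq> 0" by (simp add: Z_def simps)
  have "A * (\<Prod>r\<in>{1, 3, 5, 7, 8, 26, 28, 29, 30, 31, 33, 35}. theta72 q r) = Z"
    by (simp add: A_def Z_def simps)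
  moreover have "B * (\<Prod>r\<in>{1, 2, 5, 7, 13, 23, 28, 29, 31, 32, 34, 35}. theta72 q r) = Z"
    by (simp add: B_def Z_def simps)
  \<comment> \<open>The exponents 29 and 27 in the middle give the factor \<open>q\<close> of
    \<open>B\<close>; the signs there multiply to 1.\<close>
  moreover have "A = Z * (1 * q ^ 0) + q ^ 1 * B"
    using theta36_three_term[OF q, of "1" "(-1)" "(-1)" "1" 33 29 27 19]
    by (simp add: A_def B_def Z_def mult_ac)
  ultimately show ?thesis unfolding theta72_def[symmetric]
    by (rule quotient_identity[OF Z])
qed

lemma theta_identity_ii:
  assumes q: "0 < q" "q < 1"
  shows "1 / (\<Prod>r\<in>{1, 4, 5, 6, 11, 14, 15, 21, 25, 31, 32, 35}. qtheta (q ^ r) (q ^ 72)) =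
         1 * q ^ 6 + q ^ 0 / (\<Prod>r\<in>{1, 4, 5, 7, 10, 11, 16, 25, 26, 29, 31, 35}. qtheta (q ^ r) (q ^ 72))"
proof -
  note simps = theta36_pos_sign[OF q] theta36_neg_sign[OF q] theta72_fold[OF q(1)] theta72_nonzero[OF q]
  define Z where "Z = theta36 q 1 22 * theta36 q 1 5 * theta36 q 1 4 * theta36 q 1 1"
  define A where "A = theta36 q (-1) 15 * theta36 q (-1) 12 * theta36 q (-1) 11 * theta36 q (-1) 6"
  define B where "B = theta36 q (-1) 16 * theta36 q (-1) 11 * theta36 q (-1) 10 * theta36 q (-1) 7"
  have Z: "Z \<noteq> 0" by (simp add: Z_def simps)
  have "A * (\<Prod>r\<in>{1, 4, 5, 6, 11, 14, 15, 21, 25, 31, 32, 35}. theta72 q r) = Z"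
    by (simp add: A_def Z_def simps)
  moreover have "B * (\<Prod>r\<in>{1, 4, 5, 7, 10, 11, 16, 25, 26, 29, 31, 35}. theta72 q r) = Z"
    by (simp add: B_def Z_def simps)
  \<comment> \<open>Now \<open>Z\<close> is the left side of the three-term relation, with factor
    \<open>- q^6\<close> from \<open>(17 - 5) / 2 = 6\<close>; hence the exceptional index
    6.\<close>
  moreover have "A = Z * (1 * q ^ 6) + q ^ 0 * B"
    using theta36_three_term[OF q, of "1" "1" "(-1)" "(-1)" 27 17 5 3]
    by (simp add: A_def B_def Z_def mult_ac)
  ultimately show ?thesis unfolding theta72_def[symmetric]
    by (rule quotient_identity[OF Z])
qed

lemma theta_identity_iii:
  assumes q: "0 < q" "q < 1"
  shows "1 / (\<Prod>r\<in>{1, 7, 8, 13, 14, 17, 19, 20, 22, 23, 29, 35}. qtheta (q ^ r) (q ^ 72)) =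
         1 * q ^ 0 + q ^ 1 / (\<Prod>r\<in>{1, 6, 7, 13, 15, 16, 20, 21, 23, 29, 34, 35}. qtheta (q ^ r) (q ^ 72))"
proof -
  note simps = theta36_pos_sign[OF q] theta36_neg_sign[OF q] theta72_fold[OF q(1)] theta72_nonzero[OF q]
  define Z where "Z = theta36 q 1 20 * theta36 q 1 7 * theta36 q 1 13 * theta36 q 1 2"
  define A where "A = theta36 q (-1) 19 * theta36 q (-1) 8 * theta36 q (-1) 14 * theta36 q (-1) 1"
  define B where "B = theta36 q (-1) 21 * theta36 q (-1) 6 * theta36 q (-1) 12 * theta36 q (-1) 1"
  have Z: "Z \<noteq> 0" by (simp add: Z_def simps)
  have "A * (\<Prod>r\<in>{1, 7, 8, 13, 14, 17, 19, 20, 22, 23, 29, 35}. theta72 q r) = Z"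
    by (simp add: A_def Z_def simps)
  moreover have "B * (\<Prod>r\<in>{1, 6, 7, 13, 15, 16, 20, 21, 23, 29, 34, 35}. theta72 q r) = Z"
    by (simp add: B_def Z_def simps)
  \<comment> \<open>Equal signs now join the first and third points, so the relation reads
    \<open>- q * B = Z - A\<close>.\<close>
  moreover have "A = Z * (1 * q ^ 0) + q ^ 1 * B"
    using theta36_three_term[OF q, of "1" "(-1)" "1" "(-1)" 27 15 13 11]
    by (simp add: A_def B_def Z_def mult_ac)
  ultimately show ?thesis unfolding theta72_def[symmetric]
    by (rule quotient_identity[OF Z])
qed

lemma theta_identity_iv:
  assumes q: "0 < q" "q < 1"
  shows "1 / (\<Prod>r\<in>{2, 3, 5, 11, 16, 17, 19, 20, 25, 30, 31, 33}. qtheta (q ^ r) (q ^ 72)) =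
         (-1) * q ^ 1 + q ^ 0 / (\<Prod>r\<in>{1, 5, 8, 11, 14, 17, 19, 20, 22, 25, 31, 35}. qtheta (q ^ r) (q ^ 72))"
proof -
  note simps = theta36_pos_sign[OF q] theta36_neg_sign[OF q] theta72_fold[OF q(1)] theta72_nonzero[OF q]
  define Z where "Z = theta36 q 1 25 * theta36 q 1 2 * theta36 q 1 16 * theta36 q 1 5"
  define A where "A = theta36 q (-1) 24 * theta36 q (-1) 3 * theta36 q (-1) 17 * theta36 q (-1) 6"
  define B where "B = theta36 q (-1) 19 * theta36 q (-1) 8 * theta36 q (-1) 22 * theta36 q (-1) 1"
  have Z: "Z \<noteq> 0" by (simp add: Z_def simps)
  have "A * (\<Prod>r\<in>{2, 3, 5, 11, 16, 17, 19, 20, 25, 30, 31, 33}. theta72 q r) = Z"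
    by (simp add: A_def Z_def simps)
  moreover have "B * (\<Prod>r\<in>{1, 5, 8, 11, 14, 17, 19, 20, 22, 25, 31, 35}. theta72 q r) = Z"
    by (simp add: B_def Z_def simps)
  \<comment> \<open>The sign pattern is that of the second identity, but \<open>A\<close> and
    \<open>B\<close> trade places on the right, so \<open>Z\<close> enters with coefficient
    \<open>- q\<close>.\<close>
  moreover have "A = Z * (- 1 * q ^ 1) + q ^ 0 * B"
    using theta36_three_term[OF q, of "1" "1" "(-1)" "(-1)" 27 23 21 11]
    by (simp add: A_def B_def Z_def mult_ac)
  ultimately show ?thesis unfolding theta72_def[symmetric]
    by (rule quotient_identity[OF Z])
qed

lemma theta_identity_v:
  assumes q: "0 < q" "q < 1"
  shows "1 / (\<Prod>r\<in>{4, 7, 10, 11, 13, 16, 17, 19, 23, 25, 26, 29}. qtheta (q ^ r) (q ^ 72)) =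
         1 * q ^ 0 + q ^ 4 / (\<Prod>r\<in>{3, 4, 7, 13, 17, 19, 22, 23, 29, 30, 32, 33}. qtheta (q ^ r) (q ^ 72))"
proof -
  note simps = theta36_pos_sign[OF q] theta36_neg_sign[OF q] theta72_fold[OF q(1)] theta72_nonzero[OF q]
  define Z where "Z = theta36 q 1 14 * theta36 q 1 13 * theta36 q 1 17 * theta36 q 1 4"
  define A where "A = theta36 q (-1) 20 * theta36 q (-1) 7 * theta36 q (-1) 11 * theta36 q (-1) 10"
  define B where "B = theta36 q (-1) 24 * theta36 q (-1) 3 * theta36 q (-1) 7 * theta36 q (-1) 6"
  have Z: "Z \<noteq> 0" by (simp add: Z_def simps)
  have "A * (\<Prod>r\<in>{4, 7, 10, 11, 13, 16, 17, 19, 23, 25, 26, 29}. theta72 q r) = Z"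
    by (simp add: A_def Z_def simps)
  moreover have "B * (\<Prod>r\<in>{3, 4, 7, 13, 17, 19, 22, 23, 29, 30, 32, 33}. theta72 q r) = Z"
    by (simp add: B_def Z_def simps)
  moreover have "A = Z * (1 * q ^ 0) + q ^ 4 * B"
    using theta36_three_term[OF q, of "1" "(-1)" "(-1)" "1" 27 21 13 1]
    by (simp add: A_def B_def Z_def mult_ac)
  ultimately show ?thesis unfolding theta72_def[symmetric]
    by (rule quotient_identity[OF Z])
qed

lemma theta_identity_vi:
  assumes q: "0 < q" "q < 1"
  shows "1 / (\<Prod>r\<in>{6, 8, 10, 11, 13, 15, 17, 19, 21, 23, 25, 28}. qtheta (q ^ r) (q ^ 72)) =
         1 * q ^ 0 + q ^ 6 / (\<Prod>r\<in>{2, 5, 11, 13, 17, 19, 23, 25, 28, 31, 32, 34}. qtheta (q ^ r) (q ^ 72))"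
proof -
  note simps = theta36_pos_sign[OF q] theta36_neg_sign[OF q] theta72_fold[OF q(1)] theta72_nonzero[OF q]
  define Z where "Z = theta36 q 1 25 * theta36 q 1 10 * theta36 q 1 19 * theta36 q 1 8"
  define A where "A = theta36 q (-1) 23 * theta36 q (-1) 12 * theta36 q (-1) 21 * theta36 q (-1) 6"
  define B where "B = theta36 q (-1) 31 * theta36 q (-1) 4 * theta36 q (-1) 13 * theta36 q (-1) 2"
  have Z: "Z \<noteq> 0" by (simp add: Z_def simps)
  have "A * (\<Prod>r\<in>{6, 8, 10, 11, 13, 15, 17, 19, 21, 23, 25, 28}. theta72 q r) = Z"
    by (simp add: A_def Z_def simps)
  moreover have "B * (\<Prod>r\<in>{2, 5, 11, 13, 17, 19, 23, 25, 28, 31, 32, 34}. theta72 q r) = Z"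
    by (simp add: B_def Z_def simps)
  \<comment> \<open>The sign pairing is that of the third identity; \<open>(27 - 15) / 2 = 6\<close>
    gives the shift.\<close>
  moreover have "A = Z * (1 * q ^ 0) + q ^ 6 * B"
    using theta36_three_term[OF q, of "(-1)" "1" "(-1)" "1" 35 27 15 11]
    by (simp add: A_def B_def Z_def mult_ac)
  ultimately show ?thesis unfolding theta72_def[symmetric]
    by (rule quotient_identity[OF Z])
qed

section \<open>The six partition identities\<close>

theorem theorem18p1:
  shows "(let S = pm_residues 72 {1, 3, 5, 7, 8, 26, 28, 29, 30, 31, 33, 35};
           T = pm_residues 72 {1, 2, 5, 7, 13, 23, 28, 29, 31, 32, 34, 35}
       in \<forall>n\<ge>1. partition_count S n = partition_count T (n - 1)) \<and>
         (let S = pm_residues 72 {1, 4, 5, 6, 11, 14, 15, 21, 25, 31, 32, 35};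
           T = pm_residues 72 {1, 4, 5, 7, 10, 11, 16, 25, 26, 29, 31, 35}
       in \<forall>n. n \<noteq> 6 \<longrightarrow> partition_count S n = partition_count T n) \<and>
         (let S = pm_residues 72 {1, 7, 8, 13, 14, 17, 19, 20, 22, 23, 29, 35};
           T = pm_residues 72 {1, 6, 7, 13, 15, 16, 20, 21, 23, 29, 34, 35}
       in \<forall>n\<ge>1. partition_count S n = partition_count T (n - 1)) \<and>
         (let S = pm_residues 72 {2, 3, 5, 11, 16, 17, 19, 20, 25, 30, 31, 33};
           T = pm_residues 72 {1, 5, 8, 11, 14, 17, 19, 20, 22, 25, 31, 35}
       in \<forall>n. n \<noteq> 1 \<longrightarrow> partition_count S n = partition_count T n) \<and>
         (let S = pm_residues 72 {4, 7, 10, 11, 13, 16, 17, 19, 23, 25, 26, 29};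
           T = pm_residues 72 {3, 4, 7, 13, 17, 19, 22, 23, 29, 30, 32, 33}
       in \<forall>n\<ge>4. partition_count S n = partition_count T (n - 4)) \<and>
         (let S = pm_residues 72 {6, 8, 10, 11, 13, 15, 17, 19, 21, 23, 25, 28};
           T = pm_residues 72 {2, 5, 11, 13, 17, 19, 23, 25, 28, 31, 32, 34}
       in \<forall>n\<ge>6. partition_count S n = partition_count T (n - 6))"
proof -
  \<comment> \<open>In each case the condition on \<open>n\<close> excludes the index
    \<open>j\<close> of the monomial and ensures \<open>k \<le> n\<close>, so only the shifted count
    remains.\<close>
  have i: "partition_count (pm_residues 72 {1, 3, 5, 7, 8, 26, 28, 29, 30, 31, 33, 35}) n =
      partition_count (pm_residues 72 {1, 2, 5, 7, 13, 23, 28, 29, 31, 32, 34, 35}) (n - 1)" if "n \<ge> 1" for n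
    using partition_count_shifted[of "{1, 3, 5, 7, 8, 26, 28, 29, 30, 31, 33, 35}"
      "{1, 2, 5, 7, 13, 23, 28, 29, 31, 32, 34, 35}" 72, OF _ _ theta_identity_i, of n] that by simp
  have ii: "partition_count (pm_residues 72 {1, 4, 5, 6, 11, 14, 15, 21, 25, 31, 32, 35}) n =
      partition_count (pm_residues 72 {1, 4, 5, 7, 10, 11, 16, 25, 26, 29, 31, 35}) n" if "n \<noteq> 6" for n
    using partition_count_shifted[of "{1, 4, 5, 6, 11, 14, 15, 21, 25, 31, 32, 35}"
      "{1, 4, 5, 7, 10, 11, 16, 25, 26, 29, 31, 35}" 72, OF _ _ theta_identity_ii, of n] that by simp
  have iii: "partition_count (pm_residues 72 {1, 7, 8, 13, 14, 17, 19, 20, 22, 23, 29, 35}) n =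
      partition_count (pm_residues 72 {1, 6, 7, 13, 15, 16, 20, 21, 23, 29, 34, 35}) (n - 1)" if "n \<ge> 1" for n
    using partition_count_shifted[of "{1, 7, 8, 13, 14, 17, 19, 20, 22, 23, 29, 35}"
      "{1, 6, 7, 13, 15, 16, 20, 21, 23, 29, 34, 35}" 72, OF _ _ theta_identity_iii, of n] that by simp
  have iv: "partition_count (pm_residues 72 {2, 3, 5, 11, 16, 17, 19, 20, 25, 30, 31, 33}) n =
      partition_count (pm_residues 72 {1, 5, 8, 11, 14, 17, 19, 20, 22, 25, 31, 35}) n" if "n \<noteq> 1" for n
    using partition_count_shifted[of "{2, 3, 5, 11, 16, 17, 19, 20, 25, 30, 31, 33}"
      "{1, 5, 8, 11, 14, 17, 19, 20, 22, 25, 31, 35}" 72, OF _ _ theta_identity_iv, of n] that by simp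
  have v: "partition_count (pm_residues 72 {4, 7, 10, 11, 13, 16, 17, 19, 23, 25, 26, 29}) n =
      partition_count (pm_residues 72 {3, 4, 7, 13, 17, 19, 22, 23, 29, 30, 32, 33}) (n - 4)" if "n \<ge> 4" for n
    using partition_count_shifted[of "{4, 7, 10, 11, 13, 16, 17, 19, 23, 25, 26, 29}"
      "{3, 4, 7, 13, 17, 19, 22, 23, 29, 30, 32, 33}" 72, OF _ _ theta_identity_v, of n] that by simp
  have vi: "partition_count (pm_residues 72 {6, 8, 10, 11, 13, 15, 17, 19, 21, 23, 25, 28}) n =
      partition_count (pm_residues 72 {2, 5, 11, 13, 17, 19, 23, 25, 28, 31, 32, 34}) (n - 6)" if "n \<ge> 6" for n
    using partition_count_shifted[of "{6, 8, 10, 11, 13, 15, 17, 19, 21, 23, 25, 28}"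
      "{2, 5, 11, 13, 17, 19, 23, 25, 28, 31, 32, 34}" 72, OF _ _ theta_identity_vi, of n] that by simp
  show ?thesis
    unfolding Let_def using i ii iii iv v vi by blast
qed

end
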